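(* Let $\alpha_0\ne\beta_0$ and let $f_X(d_0)>0$ be the density of the covariate at the change point. Let $\gamma>2$ and let $\xi$ be symmetric about $0$ with $\mathbb P(|\xi|>x)=\frac{1}{1+x^\gamma}$ for $x\ge0$. Let $$F_{\ell_1}(x)=\mathbb P\Big(\operatorname{mid\,argmin}_{t\in\mathbb R}\mathrm{CPP}\big(\big|\xi+|\alpha_0-\beta_0|\big|-|\xi|,f_X(d_0)\big)(t)\le x\Big),$$ $$F_{\ell_2}(x)=\mathbb P\Big(\operatorname{mid\,argmin}_{t\in\mathbb R}\mathrm{CPP}\big(\xi+\tfrac{|\alpha_0-\beta_0|}{2},f_X(d_0)\big)(t)\le x\Big).$$ Then there exist positive constants $k_0,c_0$ (not depending on $x$) such that for all $x\ge k_0$, $$\bar F_{\ell_2}(x)=1-F_{\ell_2}(x)\ \ge\ \frac{c_0}{2f_X^\gamma(d_0)}\,x^{-\gamma}.$$ On the other hand, for all $x>0$, $$\bar F_{\ell_1}(x)=1-F_{\ell_1}(x)\ \le\ \frac{p^*}{e^{\frac{\mu_0^2}{8(\alpha_0-\beta_0)^2}}-1}\exp\left(-x f_X(d_0)\Big(1-e^{-\frac{\mu_0^2}{8(\alpha_0-\beta_0)^2}}\Big)\right),$$ where $\mu_0=\mathbb E\big[\big|\xi+|\alpha_0-\beta_0|\big|-|\xi|\big]>0$ and $$p^*=\mathbb P\Big(\min_{1\le i<\infty}\sum_{j=1}^i\big(\big|\xi_j+|\alpha_0-\beta_0|\big|-|\xi_j|\big)>0\Big)>0,$$ with $\xi_1,\xi_2,\dots$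 i.i.d. copies of $\xi$.
   Context: Two-sided compound Poisson process: for a real random variable $Z$ and $\lambda>0$, $\mathrm{CPP}(Z,\lambda)$ is the process on $\mathbb R$ equal to $\sum_{i=1}^{N_1(t)}Z_i$ for $t\ge0$ and $\sum_{i=1}^{N_2(-t)}Z_i'$ for $t<0$, where $N_1,N_2$ are independent homogeneous Poisson processes on $[0,\infty)$ with intensity $\lambda$, and $Z_i,Z_i'$ are i.i.d. copies of $Z$ independent of $N_1,N_2$. The process is piecewise constant and its minimizer is an interval; $\operatorname{mid\,argmin}$ denotes the midpoint of the minimizing interval. $F_{\ell_1}$ and $F_{\ell_2}$ are the limiting distribution functions of $n(\hat d-d_0)$ for the $\ell_1$ and $\ell_2$ change point estimators in the model $Y_i=\alpha_0\mathbf 1_{X_i\le d_0}+\beta_0\mathbf 1_{X_i>d_0}+\xi_i$, with $X_i$ independent of $\xi_i$ and having density $f_X$. *)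

theory Defs
  imports "HOL-Probability.Probability"
begin

definition generated_events ::
  "'a measure \<Rightarrow> 'b measure \<Rightarrow> 'i set \<Rightarrow> ('i \<Rightarrow> 'a \<Rightarrow> 'b) \<Rightarrow> 'a set set" where
  "generated_events M K I Y =
     sigma_sets (space M) (\<Union>i\<in>I. {Y i -` A \<inter> space M | A. A \<in> sets K})"

definition iid_copies :: "'a measure \<Rightarrow> real measure \<Rightarrow> (nat \<Rightarrow> 'a \<Rightarrow> real) \<Rightarrow> bool" where
  "iid_copies M D Z \<longleftrightarrow>
     prob_space.indep_vars M (\<lambda>_. borel) Z UNIV \<and> (\<forall>i. distr M borel (Z i) = D)"

text \<open>
  A homogeneous Poisson process on \<open>[0,\<infinity>)\<close>: a counting process with right-continuous paths and
  independent, Poisson distributed increments. Values \<open>N t\<close> at negative \<open>t\<close> are irrelevant.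
  The subtraction on \<^typ>\<open>nat\<close> does not truncate, because the paths are nondecreasing.
\<close>
definition poisson_process :: "'a measure \<Rightarrow> real \<Rightarrow> (real \<Rightarrow> 'a \<Rightarrow> nat) \<Rightarrow> bool" where
  "poisson_process M r N \<longleftrightarrow>
     0 < r \<and>
     (\<forall>t\<ge>0. N t \<in> measurable M (count_space UNIV)) \<and>
     (\<forall>\<omega>\<in>space M. N 0 \<omega> = 0 \<and> mono_on {0..} (\<lambda>t. N t \<omega>) \<and>
        (\<forall>t\<ge>0. continuous (at_right t) (\<lambda>u. N u \<omega>))) \<and>
     (\<forall>s t. 0 \<le> s \<and> s < t \<longrightarrow>
        distr M (count_space UNIV) (\<lambda>\<omega>. N t \<omega> - N s \<omega>)
          = measure_pmf (poisson_pmf (r * (t - s)))) \<and>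
     (\<forall>t :: nat \<Rightarrow> real. 0 \<le> t 0 \<and> mono t \<longrightarrow>
        prob_space.indep_vars M (\<lambda>_. count_space UNIV)
          (\<lambda>i \<omega>. N (t (Suc i)) \<omega> - N (t i) \<omega>) UNIV)"

text \<open>
  \<open>V\<close> is a realisation on \<open>M\<close> of the two-sided compound Poisson process with jump law \<open>D\<close> and
  intensity \<open>r\<close>. The jump sequences are indexed from \<open>0\<close>. The two Poisson processes and the
  two jump sequences are mutually independent, so that all jumps together are i.i.d.
\<close>
definition is_CPP :: "'a measure \<Rightarrow> real measure \<Rightarrow> real \<Rightarrow> (real \<Rightarrow> 'a \<Rightarrow> real) \<Rightarrow> bool" where
  "is_CPP M D r V \<longleftrightarrow> prob_space M \<and>
     (\<exists>N1 N2 Z Z'.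
        poisson_process M r N1 \<and> poisson_process M r N2 \<and>
        iid_copies M D Z \<and> iid_copies M D Z' \<and>
        prob_space.indep_sets M
          (\<lambda>k. [generated_events M (count_space UNIV) {0..} N1,
                generated_events M (count_space UNIV) {0..} N2,
                generated_events M borel UNIV Z,
                generated_events M borel UNIV Z'] ! k) {..<4} \<and>
        (\<forall>\<omega>\<in>space M. \<forall>t. V t \<omega> =
           (if 0 \<le> t then \<Sum>i<N1 t \<omega>. Z i \<omega> else \<Sum>i<N2 (- t) \<omega>. Z' i \<omega>)))"

text \<open>
  The minimizing set need not be an interval when the jump law has atoms (two different levels
  of the path may tie for the minimum); the midpoint is then taken between the infimum and the
  supremum of the minimizing set, i.e. it is the midpoint of its convex hull.
\<close>
definition mid_argmin :: "(real \<Rightarrow> real) \<Rightarrow> real" where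
  "mid_argmin f =
     (Inf {t. is_arg_min f (\<lambda>_. True) t} + Sup {t. is_arg_min f (\<lambda>_. True) t}) / 2"

end

theory Submission
  imports Defs
begin

text \<open>
  Read the right half of the process as a random walk \<open>S\<close> (the partial sums of the jumps) run along
  the Poisson clock \<open>N\<close>, and likewise the left half. In both models the jumps have positive mean
  and finite second moment, so almost surely both walks tend to infinity and both clocks pass
  through every natural number. Then the minimizing set is nonempty and bounded, and the last
  index \<open>J\<close> at which \<open>S\<close> attains its minimum controls it on the right: if the midpoint exceeds
  \<open>x \<ge> 0\<close>, then \<open>N x \<le> J\<close>.

  For the upper bound, \<open>J = n\<close> forces \<open>S n \<le> 0\<close>, and it forces the walk restarted at \<open>n\<close> to stay
  strictly positive for ever. The latter is independent of the first \<open>n\<close> steps and has probability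
  \<open>p*\<close>, so \<open>P (J = n) \<le> p* P (S n \<le> 0)\<close>. For steps bounded by \<open>\<delta> = \<bar>\<alpha>\<^sub>0 - \<beta>\<^sub>0\<bar>\<close> Hoeffding's
  inequality gives \<open>P (S n \<le> 0) \<le> exp (- 4 a n)\<close> with \<open>a = \<mu>\<^sub>0\<^sup>2 / (8 \<delta>\<^sup>2)\<close>, and a Chernoff bound for
  the Poisson law gives \<open>P (N x \<le> n) \<le> exp (a n) exp (- x \<lambda> (1 - exp (- a)))\<close>. Walk and clock are
  independent; summing over \<open>n\<close> leaves the factor \<open>1 / (1 - exp (- 3 a))\<close>, which is at most
  \<open>1 / (exp a - 1)\<close> since \<open>\<mu>\<^sub>0 \<le> \<delta>\<close> makes \<open>a \<le> 1 / 8\<close>. The same decomposition shows \<open>p* > 0\<close>: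
  some \<open>n\<close> is the last minimum almost surely, so not all \<open>P (J = n)\<close> can vanish.

  For the lower bound a single disastrous jump suffices. Take \<open>n\<close> of the order of \<open>2 \<lambda> (x + 1)\<close>. With
  probability bounded away from zero, the clock has made at most \<open>n\<close> steps by time \<open>x + 1\<close>, the
  right walk stays above \<open>- K\<close> for \<open>n\<close> steps and is then at most \<open>C n\<close>, and the left walk
  never falls below \<open>- K\<close>. If the next jump of the right walk is below \<open>- (C n + K)\<close>, which
  happens with probability of the order of \<open>x\<close> to the power \<open>- \<gamma>\<close>, no minimizer lies
  before \<open>x + 1\<close>.

  What makes both arguments work with second moments only is Kingman's bound on the fall of a walk:
  the maximal fall \<open>W n\<close> within \<open>n\<close> steps has the law of the waiting time recursion
  \<open>W (n + 1) = max 0 (W n - X)\<close>, and since \<open>W\<close> grows with \<open>n\<close>, comparing second moments on both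
  sides yields \<open>E (W n) \<le> E (X\<^sup>2) / (2 \<mu>)\<close>, uniformly in \<open>n\<close>.

  The distribution function of the midpoint involves the measure of a set of outcomes that must be
  measurable without discarding a null set, since the probability space may be incomplete. This holds because every path attains each of its values at rational times arbitrarily
  close to any time at which it takes that value, so that the infimum and supremum of the
  minimizing set can be computed from its rational points.
\<close>

section \<open>Walks and their last minimum\<close>

definition walk :: "(nat \<Rightarrow> real) \<Rightarrow> nat \<Rightarrow> real" where
  "walk s n = (\<Sum>i<n. s i)"

lemma walk_0 [simp]: "walk s 0 = 0"
  by (simp add: walk_def)

lemma walk_Suc [simp]: "walk s (Suc n) = walk s n + s n"
  by (simp add: walk_def)

lemma walk_shift: "walk s (n + i) = walk s n + walk (\<lambda>j. s (n + j)) i"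
  by (induction i) auto

definition last_min :: "(nat \<Rightarrow> real) \<Rightarrow> nat \<Rightarrow> bool" where
  "last_min s n \<longleftrightarrow> (\<forall>i\<le>n. walk s n \<le> walk s i) \<and> (\<forall>i>n. walk s n < walk s i)"

lemma finite_sublevel:
  fixes f :: "nat \<Rightarrow> real"
  assumes "filterlim f at_top sequentially"
  shows "finite {k. f k \<le> c}"
proof -
  have "eventually (\<lambda>k. c < f k) sequentially"
    using assms by (simp add: filterlim_at_top_dense)
  then obtain N where "\<And>k. k \<ge> N \<Longrightarrow> c < f k"
    by (auto simp: eventually_sequentially)
  then have "{k. f k \<le> c} \<subseteq> {..<N}"
    by (force simp: not_less[symmetric])
  then show ?thesis by (rule finite_subset) simp
qed

lemma last_min_exists:
  assumes lim: "filterlim (walk s) at_top sequentially"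
  obtains n where "last_min s n"
proof -
  define A where "A = {k. walk s k \<le> 0}"
  define m where "m = Min (walk s ` A)"
  define n where "n = Max {k. walk s k = m}"
  have A: "finite A" "0 \<in> A"
    unfolding A_def using finite_sublevel[OF lim] by auto
  have m_le: "m \<le> walk s k" for k
  proof (cases "k \<in> A")
    case True
    then show ?thesis using A unfolding m_def by (intro Min_le) auto
  next
    case False
    have "m \<le> walk s 0" using A unfolding m_def by (intro Min_le finite_imageI imageI)
    with False show ?thesis by (simp add: A_def)
  qed
  have "m \<in> walk s ` A" unfolding m_def using A by (intro Min_in) auto
  then have "{k. walk s k = m} \<noteq> {}" by auto
  moreover have fin: "finite {k. walk s k = m}"
    by (rule finite_subset[OF _ finite_sublevel[OF lim, of m]]) auto
  ultimately have "n \<in> {k. walk s k = m}"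
    unfolding n_def by (intro Max_in)
  moreover have "walk s k \<noteq> m" if "k > n" for k
    using that Max_ge[OF fin, of k] by (auto simp: n_def)
  ultimately have "last_min s n"
    using m_le by (fastforce simp: last_min_def order.strict_iff_order)
  then show ?thesis by (rule that)
qed

text \<open>
  An infimum of positive numbers may vanish; along a walk that tends to infinity only finitely many
  of its values compete for the infimum, so it is attained.
\<close>
lemma INF_walk_pos_iff:
  assumes lim: "filterlim (walk s) at_top sequentially"
  shows "0 < (INF i\<in>{1..}. ereal (walk s i)) \<longleftrightarrow> (\<forall>i>0. 0 < walk s i)"
proof
  assume "0 < (INF i\<in>{1..}. ereal (walk s i))"
  moreover have "(INF i\<in>{1..}. ereal (walk s i)) \<le> ereal (walk s i)" if "0 < i" for i
    using that by (intro INF_lower) auto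
  ultimately show "\<forall>i>0. 0 < walk s i"
    by (metis less_le_trans zero_ereal_def ereal_less_eq(3) ereal_less(2) less_ereal.simps(1))
next
  assume pos: "\<forall>i>0. 0 < walk s i"
  let ?A = "insert 1 (walk s ` {i. 0 < i \<and> walk s i \<le> 1})"
  have "finite {i. 0 < i \<and> walk s i \<le> 1}"
    by (rule finite_subset[OF _ finite_sublevel[OF lim, of 1]]) auto
  then have fin: "finite ?A" by simp
  then have "0 < Min ?A" using pos by (subst Min_gr_iff) auto
  moreover have "Min ?A \<le> walk s i" if "0 < i" for i
  proof (cases "walk s i \<le> 1")
    case True
    then show ?thesis using fin that by (intro Min_le) auto
  next
    case False
    have "Min ?A \<le> 1" using fin by (intro Min_le) auto
    with False show ?thesis by simp
  qed
  then have "ereal (Min ?A) \<le> (INF i\<in>{1..}. ereal (walk s i))"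
    by (intro INF_greatest) auto
  ultimately show "0 < (INF i\<in>{1..}. ereal (walk s i))"
    using less_le_trans[of 0 "ereal (Min ?A)"] by simp
qed

section \<open>Sequences of independent steps\<close>

lemma borel_measurable_pred_le [measurable (raw)]:
  fixes f g :: "'a \<Rightarrow> real"
  assumes "f \<in> borel_measurable M" and "g \<in> borel_measurable M"
  shows "Measurable.pred M (\<lambda>w. f w \<le> g w)"
  unfolding Measurable.pred_def using assms by (rule borel_measurable_le)

lemma borel_measurable_walk [measurable (raw)]:
  assumes [measurable]: "f \<in> measurable N (\<Pi>\<^sub>M i\<in>UNIV. borel)"
  shows "(\<lambda>x. walk (f x) n) \<in> borel_measurable N"
  unfolding walk_def by measurable

lemma pred_last_min [measurable (raw)]:
  assumes [measurable]: "f \<in> measurable N (\<Pi>\<^sub>M i\<in>UNIV. borel)"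
  shows "Measurable.pred N (\<lambda>x. last_min (f x) n)"
  unfolding last_min_def by measurable

text \<open>
  The law of an i.i.d. sequence is a product measure on sequences. Statements about walks are
  proved there, where restarting a walk is the shift of the sequence, and are transferred to
  arbitrary probability spaces by \<open>distr_iid_copies\<close>.
\<close>
locale iid_steps = sequence_space D for D :: "real measure" +
  assumes sets_D [measurable_cong]: "sets D = sets borel"
begin

lemma space_D [simp]: "space D = UNIV"
  using sets_eq_imp_space_eq[OF sets_D] by simp

lemma space_S [simp]: "space S = UNIV"
  by (simp add: space_PiM)

lemma sets_S: "sets S = sets (\<Pi>\<^sub>M i\<in>UNIV. borel)"
  by (intro sets_PiM_cong refl sets_D)

lemma step_measurable: "(\<lambda>s. s i) \<in> borel_measurable S"
proof -
  have "(\<lambda>s. s i) \<in> measurable S D" by measurable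
  then show ?thesis by (simp add: measurable_cong_sets[OF refl sets_D])
qed

lemma D_measurable: "(\<lambda>x. x) \<in> borel_measurable D"
  by (simp add: measurable_cong_sets[OF sets_D refl])

lemma shift_measurable: "(\<lambda>s j. s (n + j)) \<in> measurable S S"
  by (rule measurable_PiM_single') (auto simp: PiE_UNIV_domain)

lemma measurable_case_nat_pair: "(\<lambda>(x, s). case_nat x s) \<in> measurable (D \<Otimes>\<^sub>M S) S"
  using measurable_case_nat'[OF measurable_fst measurable_snd] by (simp add: case_prod_beta')

text \<open>
  Gluing the first \<open>n\<close> coordinates of one sequence to a second, independent sequence reproduces the
  product measure; an event decided by the first \<open>n\<close> steps and an event about the later steps
  become a rectangle.
\<close>
lemma prob_block_shift:
  assumes A: "A \<in> sets S" and B: "B \<in> sets S"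
    and dep: "\<And>s s'. (\<And>i. i < n \<Longrightarrow> s i = s' i) \<Longrightarrow> s \<in> A \<longleftrightarrow> s' \<in> A"
  shows "prob {s. s \<in> A \<and> (\<lambda>j. s (n + j)) \<in> B} = prob A * prob B"
proof -
  let ?X = "{s. s \<in> A \<and> (\<lambda>j. s (n + j)) \<in> B}"
  interpret SS: pair_sigma_finite S S ..
  have "?X = A \<inter> ((\<lambda>s j. s (n + j)) -` B \<inter> space S)" by auto
  then have X: "?X \<in> sets S"
    using A measurable_sets[OF shift_measurable B] by auto
  have comb: "(\<lambda>(w, w'). comb_seq n w w') -` ?X \<inter> space (S \<Otimes>\<^sub>M S) = A \<times> B"
  proof -
    have "comb_seq n w w' \<in> A \<longleftrightarrow> w \<in> A" for w w'
      by (rule dep) (simp add: comb_seq_def)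
    moreover have "(\<lambda>j. comb_seq n w w' (n + j)) = w'" for w w' :: "nat \<Rightarrow> real"
      by (simp add: comb_seq_def)
    ultimately show ?thesis by (auto simp: space_pair_measure)
  qed
  have "prob ?X = measure (distr (S \<Otimes>\<^sub>M S) S (\<lambda>(w, w'). comb_seq n w w')) ?X"
    by (simp add: PiM_comb_seq)
  also have "\<dots> = measure (S \<Otimes>\<^sub>M S) (A \<times> B)"
    using X comb by (subst measure_distr) (auto simp: measurable_comb_seq)
  also have "\<dots> = prob A * prob B"
    using A B by (simp add: measure_def P.emeasure_pair_measure_Times enn2real_mult)
  finally show ?thesis .
qed

lemma iid_copies_measurable:
  assumes "prob_space M" and "iid_copies M D Y"
  shows "(\<lambda>\<omega> i. Y i \<omega>) \<in> measurable M S"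
proof -
  interpret M': prob_space M by (rule assms(1))
  have "\<And>i. Y i \<in> borel_measurable M"
    using assms(2) by (auto simp: iid_copies_def M'.indep_vars_def)
  then have "(\<lambda>\<omega> i. Y i \<omega>) \<in> measurable M (\<Pi>\<^sub>M i\<in>UNIV. borel)"
    by (intro measurable_PiM_single') (auto simp: PiE_UNIV_domain)
  then show ?thesis by (simp add: measurable_cong_sets[OF refl sets_S])
qed

end

lemma (in prob_space) distr_iid_copies:
  assumes "iid_copies M D Z"
  shows "distr M (\<Pi>\<^sub>M i\<in>UNIV. D) (\<lambda>\<omega> i. Z i \<omega>) = (\<Pi>\<^sub>M i\<in>UNIV. D)"
proof -
  have ind: "indep_vars (\<lambda>_. borel) Z UNIV" and D: "\<And>i. distr M borel (Z i) = D"
    using assms by (auto simp: iid_copies_def)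
  have rv: "\<And>i. random_variable borel (Z i)"
    using ind by (auto simp: indep_vars_def)
  have "sets D = sets borel" using D[of 0] by (metis sets_distr)
  then have "distr M (\<Pi>\<^sub>M i\<in>UNIV. D) (\<lambda>\<omega> i. Z i \<omega>) = distr M (\<Pi>\<^sub>M i\<in>UNIV. borel) (\<lambda>\<omega>. \<lambda>i\<in>UNIV. Z i \<omega>)"
    by (intro distr_cong) (auto intro!: sets_PiM_cong)
  also have "\<dots> = (\<Pi>\<^sub>M i\<in>UNIV. D)"
    using indep_vars_iff_distr_eq_PiM[where I=UNIV and M'="\<lambda>_. borel" and X=Z] ind rv D by simp
  finally show ?thesis .
qed

section \<open>How far a walk with positive drift can fall\<close>

text \<open>
  The maximal fall of the walk with steps \<open>s i - c\<close> within \<open>n\<close> steps, written as a recursion on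
  the first step: this is Lindley's recursion for the waiting time in a queue, with the steps in
  reversed order.
\<close>
primrec dip :: "real \<Rightarrow> nat \<Rightarrow> (nat \<Rightarrow> real) \<Rightarrow> real" where
  "dip c 0 s = 0"
| "dip c (Suc n) s = max 0 (dip c n (\<lambda>j. s (Suc j)) - (s 0 - c))"

lemma walk_Suc_shift: "walk s (Suc k) = s 0 + walk (\<lambda>j. s (Suc j)) k"
  using walk_shift[of s 1 k] by simp

lemma dip_nonneg: "0 \<le> dip c n s"
  by (cases n) auto

lemma walk_ge_dip: "k \<le> n \<Longrightarrow> c * real k - dip c n s \<le> walk s k"
proof (induction n arbitrary: k s)
  case (Suc n)
  show ?case
  proof (cases k)
    case 0
    then show ?thesis using dip_nonneg[of c "Suc n" s] by simp
  next
    case (Suc l)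
    with Suc.IH[of l "\<lambda>j. s (Suc j)"] Suc.prems show ?thesis
      by (simp add: walk_Suc_shift algebra_simps max_def del: walk_Suc)
  qed
qed simp

lemma dip_mono: "dip c n s \<le> dip c (Suc n) s"
proof (induction n arbitrary: s)
  case (Suc n)
  have "dip c (Suc n) s = max 0 (dip c n (\<lambda>j. s (Suc j)) - (s 0 - c))" by simp
  also have "\<dots> \<le> max 0 (dip c (Suc n) (\<lambda>j. s (Suc j)) - (s 0 - c))"
    using Suc.IH by (intro max.mono diff_mono) simp_all
  finally show ?case by simp
qed simp

lemma borel_measurable_dip [measurable]:
  "(\<lambda>s. dip c n s) \<in> borel_measurable (\<Pi>\<^sub>M i\<in>UNIV. borel)"
proof (induction n)
  case (Suc n)
  have "(\<lambda>s j. s (Suc j)) \<in> measurable (\<Pi>\<^sub>M i\<in>UNIV. borel) (\<Pi>\<^sub>M i\<in>UNIV. borel :: real measure)"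
    by (rule measurable_PiM_single') (auto simp: PiE_UNIV_domain)
  from measurable_compose[OF this Suc] show ?case
    unfolding dip.simps by measurable
qed simp

lemma (in iid_steps) dip_measurable: "(\<lambda>s. dip c n s) \<in> borel_measurable S"
  by measurable

locale drift_walk = iid_steps +
  assumes square_integrable: "integrable D (\<lambda>x. x\<^sup>2)"
    and drift_pos: "0 < (\<integral>x. x \<partial>D)"

lemma drift_walk_of_law:
  assumes "prob_space D" and "sets D = sets borel"
    and "integrable D (\<lambda>x. x\<^sup>2)" and "0 < (\<integral>x. x \<partial>D)"
  shows "drift_walk D"
  using assms
  by (intro drift_walk.intro iid_steps.intro sequence_space.intro product_prob_spaceI
      iid_steps_axioms.intro drift_walk_axioms.intro)

context drift_walk
begin

definition drift :: real where "drift = (\<integral>x. x \<partial>D)"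

lemma step_integrable: "integrable D (\<lambda>x. x)"
  by (rule M.square_integrable_imp_integrable[OF D_measurable square_integrable])

text \<open>
  On the product space the first step is independent of the remaining sequence, which has the law
  of the whole one. Dropping the maximum with zero only increases the square, and expanding
  \<open>(W - (x - c))\<^sup>2\<close> leaves a cross term that factorizes.
\<close>
lemma dip_square_recursion:
  assumes int: "integrable S (\<lambda>s. (dip c n s)\<^sup>2)"
  shows "integrable S (\<lambda>s. (dip c (Suc n) s)\<^sup>2)"
    and "(\<integral>s. (dip c (Suc n) s)\<^sup>2 \<partial>S) \<le>
      (\<integral>s. (dip c n s)\<^sup>2 \<partial>S) - 2 * (drift - c) * (\<integral>s. dip c n s \<partial>S) + (\<integral>x. (x - c)\<^sup>2 \<partial>D)"
proof -
  interpret DS: pair_prob_space D S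
    by (intro pair_prob_space.intro pair_sigma_finite.intro M.sigma_finite_measure_axioms
        P.sigma_finite_measure_axioms M.prob_space_axioms P.prob_space_axioms)
  interpret SD: pair_sigma_finite S D
    by (intro pair_sigma_finite.intro M.sigma_finite_measure_axioms P.sigma_finite_measure_axioms)
  let ?d = "\<lambda>s. dip c n s"
  let ?q = "\<lambda>(x, s). (?d s - (x - c))\<^sup>2"
  have case_meas: "(\<lambda>(x, s). case_nat x s) \<in> measurable (D \<Otimes>\<^sub>M S) S"
    by (rule measurable_case_nat_pair)
  have xm: "fst \<in> borel_measurable (D \<Otimes>\<^sub>M S)"
    by (rule measurable_compose[OF measurable_fst D_measurable])
  have dm: "(\<lambda>p. dip c n (snd p)) \<in> borel_measurable (D \<Otimes>\<^sub>M S)"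
    by (rule measurable_compose[OF measurable_snd dip_measurable])
  have int_d: "integrable S ?d"
    by (rule P.square_integrable_imp_integrable[OF dip_measurable int])
  have int_x: "integrable (D \<Otimes>\<^sub>M S) (\<lambda>p. (fst p)\<^sup>2)"
    using square_integrable integrable_distr[of fst "D \<Otimes>\<^sub>M S" D "\<lambda>x. x\<^sup>2"]
    by (simp add: P.distr_pair_fst)
  have int_s: "integrable (D \<Otimes>\<^sub>M S) (\<lambda>p. (?d (snd p))\<^sup>2)"
  proof -
    have "integrable (S \<Otimes>\<^sub>M D) (\<lambda>p. (?d (fst p))\<^sup>2)"
      using int integrable_distr[of fst "S \<Otimes>\<^sub>M D" S "\<lambda>x. (?d x)\<^sup>2"]
      by (simp add: prob_space.distr_pair_fst[OF prob_space])
    from SD.integrable_product_swap[OF this] show ?thesis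
      by (simp add: case_prod_beta')
  qed
  have int_q: "integrable (D \<Otimes>\<^sub>M S) ?q"
  proof (rule Bochner_Integration.integrable_bound)
    show "integrable (D \<Otimes>\<^sub>M S) (\<lambda>p. 2 * (?d (snd p))\<^sup>2 + 4 * (fst p)\<^sup>2 + 4 * c\<^sup>2)"
      using int_x int_s
      by (intro Bochner_Integration.integrable_add integrable_mult_right DS.P.integrable_const)
    have "(a - (b - c))\<^sup>2 \<le> 2 * a\<^sup>2 + 4 * b\<^sup>2 + 4 * c\<^sup>2" for a b :: real
      using zero_le_power2[of "a + (b - c)"] zero_le_power2[of "b + c"]
      by (simp add: power2_eq_square algebra_simps)
    then show "AE p in D \<Otimes>\<^sub>M S. norm (?q p) \<le> norm (2 * (?d (snd p))\<^sup>2 + 4 * (fst p)\<^sup>2 + 4 * c\<^sup>2)"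
      by (intro AE_I2) (simp add: case_prod_beta')
    have "(\<lambda>p. (dip c n (snd p) - (fst p - c))\<^sup>2) \<in> borel_measurable (D \<Otimes>\<^sub>M S)"
      by (intro borel_measurable_power borel_measurable_diff borel_measurable_const dm xm)
    then show "?q \<in> borel_measurable (D \<Otimes>\<^sub>M S)"
      by (simp add: case_prod_beta')
  qed
  have le_q: "(dip c (Suc n) (case_nat x s))\<^sup>2 \<le> (?d s - (x - c))\<^sup>2" for x s
    by (auto simp: max_def)
  have int_c: "integrable (D \<Otimes>\<^sub>M S) (\<lambda>(x, s). (dip c (Suc n) (case_nat x s))\<^sup>2)"
  proof (rule Bochner_Integration.integrable_bound[OF int_q])
    have "(\<lambda>p. (dip c (Suc n) ((\<lambda>(x, s). case_nat x s) p))\<^sup>2) \<in> borel_measurable (D \<Otimes>\<^sub>M S)"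
      by (rule borel_measurable_power[OF measurable_compose[OF case_meas dip_measurable]])
    then show "(\<lambda>(x, s). (dip c (Suc n) (case_nat x s))\<^sup>2) \<in> borel_measurable (D \<Otimes>\<^sub>M S)"
      by (simp add: case_prod_beta' del: dip.simps)
  qed (use le_q in \<open>auto simp: case_prod_beta simp del: dip.simps\<close>)
  have sq_meas: "(\<lambda>s. (dip c (Suc n) s)\<^sup>2) \<in> borel_measurable S"
    using dip_measurable by (intro borel_measurable_power)
  show "integrable S (\<lambda>s. (dip c (Suc n) s)\<^sup>2)"
    using int_c by (subst PiM_iter[symmetric], subst integrable_distr_eq[OF case_meas sq_meas])
      (simp add: case_prod_beta' del: dip.simps)
  have "(\<integral>s. (dip c (Suc n) s)\<^sup>2 \<partial>S) = (\<integral>p. (case p of (x, s) \<Rightarrow> (dip c (Suc n) (case_nat x s))\<^sup>2) \<partial>(D \<Otimes>\<^sub>M S))"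
    by (subst PiM_iter[symmetric], subst integral_distr[OF case_meas sq_meas])
      (simp add: case_prod_beta' del: dip.simps)
  also have "\<dots> \<le> (\<integral>p. ?q p \<partial>(D \<Otimes>\<^sub>M S))"
    using int_c int_q by (rule integral_mono) (use le_q in \<open>auto simp del: dip.simps\<close>)
  also have "\<dots> = (\<integral>s. (\<integral>x. (?d s - (x - c))\<^sup>2 \<partial>D) \<partial>S)"
    using DS.integral_snd[OF int_q] by simp
  also have "\<dots> = (\<integral>s. (?d s)\<^sup>2 - 2 * (drift - c) * ?d s + (\<integral>x. (x - c)\<^sup>2 \<partial>D) \<partial>S)"
  proof (rule Bochner_Integration.integral_cong[OF refl])
    fix s
    have int_xc: "integrable D (\<lambda>x. (x - c)\<^sup>2)"
      using square_integrable step_integrable by (simp add: power2_diff)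
    have "(\<integral>x. (?d s - (x - c))\<^sup>2 \<partial>D) = (\<integral>x. (?d s)\<^sup>2 - 2 * ?d s * (x - c) + (x - c)\<^sup>2 \<partial>D)"
      by (rule Bochner_Integration.integral_cong[OF refl]) (simp add: power2_eq_square algebra_simps)
    also have "\<dots> = (\<integral>x. (?d s)\<^sup>2 - 2 * ?d s * (x - c) \<partial>D) + (\<integral>x. (x - c)\<^sup>2 \<partial>D)"
      using int_xc step_integrable by (intro Bochner_Integration.integral_add) auto
    also have "(\<integral>x. (?d s)\<^sup>2 - 2 * ?d s * (x - c) \<partial>D) = (?d s)\<^sup>2 - 2 * ?d s * (drift - c)"
      using step_integrable M.prob_space by (simp add: drift_def)
    finally show "(\<integral>x. (?d s - (x - c))\<^sup>2 \<partial>D) =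
      (?d s)\<^sup>2 - 2 * (drift - c) * ?d s + (\<integral>x. (x - c)\<^sup>2 \<partial>D)"
      by simp
  qed
  also have "\<dots> = (\<integral>s. (?d s)\<^sup>2 \<partial>S) - 2 * (drift - c) * (\<integral>s. ?d s \<partial>S) + (\<integral>x. (x - c)\<^sup>2 \<partial>D)"
    using int int_d P.prob_space by simp
  finally show "(\<integral>s. (dip c (Suc n) s)\<^sup>2 \<partial>S) \<le>
      (\<integral>s. (?d s)\<^sup>2 \<partial>S) - 2 * (drift - c) * (\<integral>s. ?d s \<partial>S) + (\<integral>x. (x - c)\<^sup>2 \<partial>D)" .
qed

lemma dip_square_integrable: "integrable S (\<lambda>s. (dip c n s)\<^sup>2)"
proof (induction n)
  case 0
  show ?case by simp
qed (rule dip_square_recursion(1))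

lemma dip_integrable: "integrable S (\<lambda>s. dip c n s)"
  by (rule P.square_integrable_imp_integrable[OF dip_measurable dip_square_integrable])

text \<open>
  Since the fall grows with \<open>n\<close>, so does its second moment. The recursion therefore bounds the
  first moment uniformly in \<open>n\<close>.
\<close>
lemma expectation_dip_le:
  assumes "c < drift"
  shows "(\<integral>s. dip c n s \<partial>S) \<le> (\<integral>x. (x - c)\<^sup>2 \<partial>D) / (2 * (drift - c))"
proof -
  \<comment> \<open>Together with the recursion this cancels the second moments of the fall.\<close>
  have "(\<integral>s. (dip c n s)\<^sup>2 \<partial>S) \<le> (\<integral>s. (dip c (Suc n) s)\<^sup>2 \<partial>S)"
    by (intro integral_mono dip_square_integrable power_mono dip_mono dip_nonneg)
  with dip_square_recursion(2)[OF dip_square_integrable, of c n]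
  have "2 * (drift - c) * (\<integral>s. dip c n s \<partial>S) \<le> (\<integral>x. (x - c)\<^sup>2 \<partial>D)"
    by linarith
  then show ?thesis using assms by (simp add: pos_le_divide_eq mult.commute)
qed

lemma prob_below_line:
  assumes "c < drift" and "0 < K"
  shows "prob {s. \<exists>k. walk s k < c * real k - K} \<le>
    (\<integral>x. (x - c)\<^sup>2 \<partial>D) / (2 * (drift - c)) / K"
proof -
  define A where "A = (\<lambda>n. {s \<in> space S. \<exists>k\<le>n. walk s k < c * real k - K})"
  have A_sets: "A n \<in> sets S" for n
    unfolding A_def by measurable
  have "(\<lambda>n. prob (A n)) \<longlonglongrightarrow> prob (\<Union>n. A n)"
  proof (rule P.finite_Lim_measure_incseq)
    show "incseq A"
      unfolding incseq_def A_def by (intro allI impI Collect_mono) (meson order_trans)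
  qed (use A_sets in auto)
  moreover have "(\<Union>n. A n) = {s. \<exists>k. walk s k < c * real k - K}"
    by (auto simp: A_def)
  moreover have "prob (A n) \<le> (\<integral>x. (x - c)\<^sup>2 \<partial>D) / (2 * (drift - c)) / K" for n
  proof -
    have "prob (A n) \<le> prob {s \<in> space S. dip c n s \<ge> K}"
    proof (rule P.finite_measure_mono)
      show "A n \<subseteq> {s \<in> space S. dip c n s \<ge> K}"
      proof
        fix s assume "s \<in> A n"
        then obtain k where "k \<le> n" "walk s k < c * real k - K" by (auto simp: A_def)
        with walk_ge_dip[of k n c s] show "s \<in> {s \<in> space S. dip c n s \<ge> K}" by auto
      qed
    qed (intro borel_measurable_le borel_measurable_const dip_measurable)
    also have "\<dots> \<le> (\<integral>s. dip c n s \<partial>S) / K"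
      using \<open>0 < K\<close> dip_nonneg
      by (intro integral_Markov_inequality_measure[where A="{}"] dip_integrable) auto
    also have "\<dots> \<le> (\<integral>x. (x - c)\<^sup>2 \<partial>D) / (2 * (drift - c)) / K"
      using expectation_dip_le[OF \<open>c < drift\<close>] \<open>0 < K\<close> by (intro divide_right_mono) auto
    finally show ?thesis .
  qed
  ultimately show ?thesis by (intro LIMSEQ_le_const2) auto
qed

text \<open>
  The fall below the line of slope half the drift is almost surely bounded, and that line tends to
  infinity.
\<close>
lemma AE_walk_at_top: "AE s in S. filterlim (walk s) at_top sequentially"
proof -
  \<comment> \<open>Any slope strictly between zero and the drift would do.\<close>
  define c where "c = drift / 2"
  have c: "0 < c" "c < drift" using drift_pos by (auto simp: c_def drift_def)
  define B where "B = (\<integral>x. (x - c)\<^sup>2 \<partial>D) / (2 * (drift - c))"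
  define A where "A = {s \<in> space S. \<forall>K::nat. \<exists>k. walk s k < c * real k - real (Suc K)}"
  have A_sets: "A \<in> sets S" unfolding A_def by measurable
  have "prob A \<le> B / real (Suc K)" for K :: nat
  proof -
    have "{s \<in> space S. \<exists>k. walk s k < c * real k - real (Suc K)} \<in> sets S" by measurable
    then have "prob A \<le> prob {s. \<exists>k. walk s k < c * real k - real (Suc K)}"
      by (intro P.finite_measure_mono) (auto simp: A_def)
    also have "\<dots> \<le> B / real (Suc K)"
      unfolding B_def by (intro prob_below_line c) simp
    finally show ?thesis .
  qed
  then have "prob A \<le> 0"
    by (intro LIMSEQ_le_const[OF LIMSEQ_Suc[OF lim_const_over_n[of B]]]) auto
  then have "prob A = 0" by (intro antisym) auto
  then have "AE s in S. s \<notin> A"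
    using A_sets by (simp add: AE_iff_measurable[of A] P.emeasure_eq_measure)
  then show ?thesis
  proof (rule eventually_mono)
    fix s assume "s \<notin> A"
    then obtain K :: nat where K: "\<And>k. c * real k - real (Suc K) \<le> walk s k"
      by (auto simp: A_def not_less)
    have "filterlim (\<lambda>k. c * real k - real (Suc K)) at_top sequentially"
      using filterlim_tendsto_add_at_top[OF tendsto_const[of "- real (Suc K)"]
        filterlim_tendsto_pos_mult_at_top[OF tendsto_const[of c] c(1) filterlim_real_sequentially]]
      by (simp add: algebra_simps)
    then show "filterlim (walk s) at_top sequentially"
      by (rule filterlim_at_top_mono) (use K in auto)
  qed
qed

text \<open>
  The probability called \<open>p*\<close> above; \<open>escape_eq_INF\<close> relates it to the infimum of the walk.
\<close>
definition escape :: real where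
  "escape = prob {s. \<forall>i>0. 0 < walk s i}"

text \<open>
  The walk up to its last minimum and the walk restarted there are independent; the strict
  inequality for later indices is what makes the second factor the escape probability.
\<close>
lemma prob_last_min_le: "prob {s. last_min s n} \<le> prob {s. walk s n \<le> 0} * escape"
proof -
  let ?A = "{s. walk s n \<le> 0}" and ?B = "{s. \<forall>i>0. 0 < walk s i}"
  have A: "{s \<in> space S. walk s n \<le> 0} \<in> sets S" by measurable
  have B: "{s \<in> space S. \<forall>i>0. 0 < walk s i} \<in> sets S" by measurable
  have "last_min s n \<Longrightarrow> walk s n \<le> 0" for s
    unfolding last_min_def by (metis walk_0 zero_le)
  moreover have "(\<lambda>j. s (n + j)) \<in> ?B" if "last_min s n" for s
  proof -
    have "walk s n < walk s (n + i)" if "0 < i" for i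
      using \<open>last_min s n\<close> that by (simp add: last_min_def)
    then show ?thesis by (simp add: walk_shift)
  qed
  ultimately have sub: "{s. last_min s n} \<subseteq> {s. s \<in> ?A \<and> (\<lambda>j. s (n + j)) \<in> ?B}"
    by auto
  have eq: "{s. s \<in> ?A \<and> (\<lambda>j. s (n + j)) \<in> ?B} = ?A \<inter> ((\<lambda>s j. s (n + j)) -` ?B \<inter> space S)" by auto
  have "{s. s \<in> ?A \<and> (\<lambda>j. s (n + j)) \<in> ?B} \<in> sets S"
    unfolding eq using A measurable_sets[OF shift_measurable[of n], of ?B] B by auto
  with sub have "prob {s. last_min s n} \<le> prob {s. s \<in> ?A \<and> (\<lambda>j. s (n + j)) \<in> ?B}"
    by (rule P.finite_measure_mono)
  also have "\<dots> = prob ?A * prob ?B"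
  proof (rule prob_block_shift)
    fix s s' :: "nat \<Rightarrow> real" assume "\<And>i. i < n \<Longrightarrow> s i = s' i"
    then have "walk s n = walk s' n" unfolding walk_def by (intro sum.cong) auto
    then show "s \<in> ?A \<longleftrightarrow> s' \<in> ?A" by simp
  qed (use A B in simp_all)
  finally show ?thesis by (simp add: escape_def)
qed

text \<open>
  A walk that tends to infinity has a last minimum, so the countably many events
  \<open>last_min s n\<close> cover the space up to a null set and cannot all be null.
\<close>
lemma escape_pos: "0 < escape"
proof (rule ccontr)
  assume "\<not> 0 < escape"
  moreover have "0 \<le> escape" unfolding escape_def by (rule measure_nonneg)
  ultimately have "escape = 0" by linarith
  then have null: "prob {s. last_min s n} = 0" for n
    using prob_last_min_le[of n] measure_nonneg[of S "{s. last_min s n}"] by simp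
  have "AE s in S. \<not> last_min s n" for n
  proof -
    have "{s \<in> space S. last_min s n} \<in> sets S" by measurable
    then show ?thesis
      using null[of n] by (simp add: AE_iff_measurable[of "{s. last_min s n}"] P.emeasure_eq_measure)
  qed
  then have "AE s in S. \<forall>n. \<not> last_min s n" by (simp add: AE_all_countable)
  with AE_walk_at_top have "AE s in S. False"
    by eventually_elim (use last_min_exists in blast)
  then show False by simp
qed

lemma steps_independent: "P.indep_vars (\<lambda>_. borel) (\<lambda>i s. s i) UNIV"
  and distr_step: "distr S borel (\<lambda>s. s i) = D"
proof -
  have d: "distr S borel (\<lambda>s. s i) = D" for i
  proof -
    have "distr S borel (\<lambda>s. s i) = distr S D (\<lambda>s. s i)"
      by (rule distr_cong[OF refl _ refl]) (rule sets_D[symmetric])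
    also have "\<dots> = D" by (rule PiM_component) simp
    finally show ?thesis .
  qed
  then show "distr S borel (\<lambda>s. s i) = D" .
  have "distr S (\<Pi>\<^sub>M i\<in>UNIV. borel) (\<lambda>s. \<lambda>i\<in>UNIV. s i) = distr S S (\<lambda>s. s)"
    by (rule distr_cong[OF refl]) (auto intro!: sets_PiM_cong sets_D[symmetric])
  then show "P.indep_vars (\<lambda>_. borel) (\<lambda>i s. s i) UNIV"
    by (subst P.indep_vars_iff_distr_eq_PiM) (simp_all add: d step_measurable)
qed

lemma prob_walk_nonpos_le:
  assumes b: "0 < b" and bounded: "AE x in D. \<bar>x\<bar> \<le> b"
  shows "prob {s. walk s n \<le> 0} \<le> exp (- (real n * drift\<^sup>2 / (2 * b\<^sup>2)))"
proof (cases "n = 0")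
  case True
  then show ?thesis by simp
next
  case False
  have ex: "P.expectation (\<lambda>s. s 0) = drift"
    unfolding drift_def
    by (subst distr_step[of 0, symmetric], subst integral_distr[OF step_measurable]) simp_all
  have "AE x in distr S borel (\<lambda>s. s 0). \<bar>x\<bar> \<le> b"
    using bounded by (subst distr_step)
  then have "AE s in S. \<bar>s 0\<bar> \<le> b"
    by (rule AE_distrD[OF step_measurable])
  then have bd: "AE s in S. s 0 \<in> {- b..b}"
    by eventually_elim auto
  interpret H: Hoeffding_ineq_iid S "{..<n}" "\<lambda>i s. s i" "\<lambda>s. s 0" "- b" b drift
  proof unfold_locales
    show "P.indep_vars (\<lambda>_. borel) (\<lambda>i s. s i) {..<n}"
      by (rule P.indep_vars_subset[OF steps_independent]) auto
    show "AE s in S. s 0 \<in> {- b..b}" by (rule bd)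
  qed (simp_all add: distr_step ex step_measurable)
  have "prob {s \<in> space S. (\<Sum>i<n. s i) \<le> real (card {..<n}) * drift - real n * drift} \<le>
      exp (- 2 * (real n * drift)\<^sup>2 / (real (card {..<n}) * (b - - b)\<^sup>2))"
    using False b drift_pos by (intro H.Hoeffding_ineq_le) (auto simp: drift_def)
  also have "- 2 * (real n * drift)\<^sup>2 / (real (card {..<n}) * (b - - b)\<^sup>2) = - (real n * drift\<^sup>2 / (2 * b\<^sup>2))"
    using False b by (simp add: field_simps power2_eq_square)
  finally show ?thesis by (simp add: walk_def)
qed

end

lemma (in drift_walk) escape_eq_INF:
  assumes P: "prob_space P" and Y: "iid_copies P D Y"
  shows "measure P {\<omega> \<in> space P. 0 < (INF i\<in>{1..}. ereal (\<Sum>j<i. Y j \<omega>))} = escape"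
proof -
  interpret P': prob_space P by (rule P)
  note Ym = iid_copies_measurable[OF P Y]
  let ?I = "{s. 0 < (INF i\<in>{1..}. ereal (walk s i))}"
  have I: "{s \<in> space S. 0 < (INF i\<in>{1..}. ereal (walk s i))} \<in> sets S" by measurable
  have E: "{s \<in> space S. \<forall>i>0. 0 < walk s i} \<in> sets S" by measurable
  have "{\<omega> \<in> space P. 0 < (INF i\<in>{1..}. ereal (\<Sum>j<i. Y j \<omega>))} = (\<lambda>\<omega> i. Y i \<omega>) -` ?I \<inter> space P"
    by (auto simp: walk_def)
  also have "measure P \<dots> = measure (distr P S (\<lambda>\<omega> i. Y i \<omega>)) ?I"
    using I by (intro measure_distr[symmetric] Ym) simp
  also have "\<dots> = prob ?I" by (simp only: P'.distr_iid_copies[OF Y])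
  also have "\<dots> = escape"
    unfolding escape_def
  proof (rule measure_eq_AE)
    show "AE s in S. s \<in> ?I \<longleftrightarrow> s \<in> {s. \<forall>i>0. 0 < walk s i}"
      using AE_walk_at_top by eventually_elim (simp only: mem_Collect_eq INF_walk_pos_iff)
  qed (use I E in simp_all)
  finally show ?thesis .
qed

section \<open>The midpoint of the minimizing set as a random variable\<close>

text \<open>
  Both suprema are the least element of the same set of upper bounds. This
  covers the conventional values of the supremum at empty and at unbounded sets.
\<close>
lemma Sup_cong_dense:
  fixes A B :: "real set"
  assumes "B \<subseteq> A" and dense: "\<And>t e. t \<in> A \<Longrightarrow> 0 < e \<Longrightarrow> \<exists>q\<in>B. \<bar>q - t\<bar> < e"
  shows "Sup A = Sup B"
proof -
  have "(\<forall>x\<in>A. x \<le> z) \<longleftrightarrow> (\<forall>x\<in>B. x \<le> z)" for z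
  proof
    assume B: "\<forall>x\<in>B. x \<le> z"
    show "\<forall>x\<in>A. x \<le> z"
    proof (rule ballI, rule field_le_epsilon)
      fix t e :: real assume "t \<in> A" "0 < e"
      then obtain q where "q \<in> B" "\<bar>q - t\<bar> < e" using dense[of t e] by auto
      moreover from \<open>q \<in> B\<close> B have "q \<le> z" by blast
      ultimately show "t \<le> z + e" by linarith
    qed
  qed (use assms(1) in auto)
  then show ?thesis by (simp add: Sup_real_def)
qed

lemma Inf_cong_dense:
  fixes A B :: "real set"
  assumes "B \<subseteq> A" and dense: "\<And>t e. t \<in> A \<Longrightarrow> 0 < e \<Longrightarrow> \<exists>q\<in>B. \<bar>q - t\<bar> < e"
  shows "Inf A = Inf B"
proof -
  have "Sup (uminus ` A) = Sup (uminus ` B)"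
  proof (rule Sup_cong_dense)
    fix t e :: real assume "t \<in> uminus ` A" "0 < e"
    then obtain u where "u \<in> A" "t = - u" by auto
    with dense[of u e] \<open>0 < e\<close> obtain q where "q \<in> B" "\<bar>q - u\<bar> < e" by auto
    then show "\<exists>q\<in>uminus ` B. \<bar>q - t\<bar> < e"
      using \<open>t = - u\<close> by (intro bexI[of _ "- q"]) auto
  qed (use assms(1) in auto)
  then show ?thesis by (simp add: Inf_real_def)
qed

text \<open>
  A real supremum has one fixed value on the empty set and another one on all sets that are
  unbounded above, so measurability holds on all outcomes.
\<close>
lemma borel_measurable_Sup_rat:
  assumes [measurable]: "\<And>q::rat. Measurable.pred M (B q)"
  shows "(\<lambda>\<omega>. Sup {real_of_rat q |q. B q \<omega>}) \<in> borel_measurable M"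
proof (rule borel_measurableI_le)
  fix a :: real
  \<comment> \<open>The value of the supremum of a set without upper bound.\<close>
  define c where "c = (LEAST z::real. False)"
  define c0 where "c0 = (Sup {} :: real)"
  have Sup_le: "Sup X \<le> a \<longleftrightarrow> (if X = {} then c0 \<le> a
      else if \<exists>k::nat. \<forall>x\<in>X. x \<le> real k then \<forall>x\<in>X. x \<le> a else c \<le> a)" for X :: "real set"
  proof (cases "X = {}")
    case False
    show ?thesis
    proof (cases "\<exists>k::nat. \<forall>x\<in>X. x \<le> real k")
      case True
      then have "bdd_above X" by (auto simp: bdd_above_def)
      with False True show ?thesis by (simp add: cSup_le_iff)
    next
      case nb: False
      have "\<not> (\<forall>x\<in>X. x \<le> z)" for z
      proof
        assume "\<forall>x\<in>X. x \<le> z"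
        then have "\<forall>x\<in>X. x \<le> real (nat \<lceil>z\<rceil>)" by (meson of_nat_ceiling order_trans)
        with nb show False by blast
      qed
      then have "(\<lambda>z. \<forall>x\<in>X. x \<le> z) = (\<lambda>_. False)" by (intro ext) blast
      then have "Sup X = c" unfolding Sup_real_def c_def by (rule arg_cong[of _ _ Least])
      with False nb show ?thesis by (simp, blast)
    qed
  qed (simp add: c0_def)
  have "{\<omega> \<in> space M. Sup {real_of_rat q |q. B q \<omega>} \<le> a} =
    {\<omega> \<in> space M. if \<forall>q. \<not> B q \<omega> then c0 \<le> a
      else if \<exists>k::nat. \<forall>q. B q \<omega> \<longrightarrow> real_of_rat q \<le> real k
        then \<forall>q. B q \<omega> \<longrightarrow> real_of_rat q \<le> a else c \<le> a}"
    by (simp add: setcompr_eq_image Sup_le)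
  also have "\<dots> \<in> sets M" by measurable
  finally show "{\<omega> \<in> space M. Sup {real_of_rat q |q. B q \<omega>} \<le> a} \<in> sets M" .
qed

text \<open>
  Right continuity alone would not do: it fails on the negative axis, where the process is left
  continuous. What both halves share is that any value is repeated at nearby rational times.
\<close>
definition rationally_traced :: "(real \<Rightarrow> real) \<Rightarrow> bool" where
  "rationally_traced v \<longleftrightarrow>
     (\<forall>t e. 0 < e \<longrightarrow> (\<exists>q. \<bar>real_of_rat q - t\<bar> < e \<and> v (real_of_rat q) = v t))"

text \<open>
  A rational time minimizes the path as soon as it does so among rational times, and every
  minimizer has rational minimizers arbitrarily close to it.
\<close>
lemma mid_argmin_rational:
  assumes v: "rationally_traced v"
  defines "B \<equiv> {real_of_rat q |q. \<forall>q'. v (real_of_rat q) \<le> v (real_of_rat q')}"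
  shows "mid_argmin v = (Inf B + Sup B) / 2"
proof -
  define A where "A = {t. is_arg_min v (\<lambda>_. True) t}"
  have A_iff: "t \<in> A \<longleftrightarrow> (\<forall>q. v t \<le> v (real_of_rat q))" for t
  proof
    assume q: "\<forall>q. v t \<le> v (real_of_rat q)"
    have "v t \<le> v u" for u
    proof -
      obtain q where "v (real_of_rat q) = v u"
        using v zero_less_one unfolding rationally_traced_def by metis
      with q show ?thesis by metis
    qed
    then show "t \<in> A" by (auto simp: A_def is_arg_min_def not_less)
  qed (auto simp: A_def is_arg_min_def not_less)
  have B: "B = A \<inter> range real_of_rat"
    by (auto simp: B_def A_iff)
  have dense: "\<exists>q\<in>B. \<bar>q - t\<bar> < e" if "t \<in> A" "0 < e" for t e
  proof -
    obtain q where "\<bar>real_of_rat q - t\<bar> < e" "v (real_of_rat q) = v t"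
      using v \<open>0 < e\<close> unfolding rationally_traced_def by blast
    with \<open>t \<in> A\<close> show ?thesis by (auto simp: B A_iff)
  qed
  have "Inf A = Inf B" "Sup A = Sup B"
    using dense by (intro Inf_cong_dense Sup_cong_dense; auto simp: B)+
  then show ?thesis by (simp add: mid_argmin_def A_def)
qed

lemma borel_measurable_mid_argmin:
  assumes [measurable]: "\<And>t. V t \<in> borel_measurable M"
    and traced: "\<And>\<omega>. \<omega> \<in> space M \<Longrightarrow> rationally_traced (\<lambda>t. V t \<omega>)"
  shows "(\<lambda>\<omega>. mid_argmin (\<lambda>t. V t \<omega>)) \<in> borel_measurable M"
proof -
  define B where "B q \<omega> \<longleftrightarrow> (\<forall>q'. V (real_of_rat q) \<omega> \<le> V (real_of_rat q') \<omega>)" for q \<omega>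
  have [measurable]: "Measurable.pred M (B q)" for q
    unfolding B_def by measurable
  have [measurable]: "(\<lambda>\<omega>. Sup {real_of_rat q |q. B q \<omega>}) \<in> borel_measurable M"
    by (rule borel_measurable_Sup_rat) measurable
  have [measurable]: "(\<lambda>\<omega>. Sup {real_of_rat q |q. B (- q) \<omega>}) \<in> borel_measurable M"
    by (rule borel_measurable_Sup_rat) measurable
  have eq: "mid_argmin (\<lambda>t. V t \<omega>) =
      (- Sup {real_of_rat q |q. B (- q) \<omega>} + Sup {real_of_rat q |q. B q \<omega>}) / 2"
    if "\<omega> \<in> space M" for \<omega>
  proof -
    have "uminus ` {real_of_rat q |q. B q \<omega>} = {real_of_rat q |q. B (- q) \<omega>}"
    proof (intro equalityI subsetI)
      fix x assume "x \<in> {real_of_rat q |q. B (- q) \<omega>}"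
      then obtain q where "x = real_of_rat q" "B (- q) \<omega>" by auto
      then have "real_of_rat (- q) \<in> {real_of_rat q |q. B q \<omega>}" by blast
      then show "x \<in> uminus ` {real_of_rat q |q. B q \<omega>}"
        using \<open>x = real_of_rat q\<close> by (intro image_eqI[of _ _ "real_of_rat (- q)"]) (simp_all add: of_rat_minus)
    next
      fix x assume "x \<in> uminus ` {real_of_rat q |q. B q \<omega>}"
      then obtain q where "x = real_of_rat (- q)" "B (- (- q)) \<omega>" by (auto simp: of_rat_minus)
      then show "x \<in> {real_of_rat q |q. B (- q) \<omega>}" by blast
    qed
    then show ?thesis
      using mid_argmin_rational[OF traced[OF that]] by (simp add: B_def[symmetric] Inf_real_def)
  qed
  have "(\<lambda>\<omega>. (- Sup {real_of_rat q |q. B (- q) \<omega>} + Sup {real_of_rat q |q. B q \<omega>}) / 2)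
      \<in> borel_measurable M"
    by measurable
  then show ?thesis by (simp only: measurable_cong[OF eq])
qed

section \<open>Paths of a two-sided compound process\<close>

definition counting_path :: "(real \<Rightarrow> nat) \<Rightarrow> bool" where
  "counting_path n \<longleftrightarrow> n 0 = 0 \<and> mono_on {0..} n \<and> (\<forall>t\<ge>0. continuous (at_right t) n)"

lemma counting_path_right_constant:
  assumes "counting_path n" and "0 \<le> t"
  obtains b where "t < b" and "\<And>u. t \<le> u \<Longrightarrow> u < b \<Longrightarrow> n u = n t"
proof -
  have "(n \<longlongrightarrow> n t) (at_right t)"
    using assms by (auto simp: counting_path_def continuous_within)
  then have "\<forall>\<^sub>F u in at_right t. n u = n t" by (simp add: tendsto_discrete)
  then obtain b where "b > t" "\<And>u. u > t \<Longrightarrow> u < b \<Longrightarrow> n u = n t"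
    by (auto simp: eventually_at_right_field)
  then show ?thesis by (intro that[of b]) (auto simp: order_le_less)
qed

definition two_sided ::
  "(real \<Rightarrow> nat) \<Rightarrow> (real \<Rightarrow> nat) \<Rightarrow> (nat \<Rightarrow> real) \<Rightarrow> (nat \<Rightarrow> real) \<Rightarrow> real \<Rightarrow> real" where
  "two_sided n1 n2 s s' t = (if 0 \<le> t then walk s (n1 t) else walk s' (n2 (- t)))"

lemma rationally_traced_two_sided:
  assumes "counting_path n1" and "counting_path n2"
  shows "rationally_traced (two_sided n1 n2 s s')"
  unfolding rationally_traced_def
proof (intro allI impI)
  fix t e :: real assume "0 < e"
  show "\<exists>q. \<bar>real_of_rat q - t\<bar> < e \<and> two_sided n1 n2 s s' (real_of_rat q) = two_sided n1 n2 s s' t"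
  proof (cases "0 \<le> t")
    case True
    then obtain b where b: "t < b" "\<And>u. t \<le> u \<Longrightarrow> u < b \<Longrightarrow> n1 u = n1 t"
      using counting_path_right_constant[OF assms(1)] by metis
    obtain q where "t < real_of_rat q" "real_of_rat q < min b (t + e)"
      using of_rat_dense[of t "min b (t + e)"] b(1) \<open>0 < e\<close> by auto
    moreover from this True have "0 \<le> real_of_rat q" by linarith
    ultimately show ?thesis
      using b(2)[of "real_of_rat q"] True by (intro exI[of _ q]) (auto simp: two_sided_def)
  next
    case False
    then obtain b where b: "- t < b" "\<And>u. - t \<le> u \<Longrightarrow> u < b \<Longrightarrow> n2 u = n2 (- t)"
      using counting_path_right_constant[OF assms(2), of "- t"] by auto
    obtain q where "max (- b) (t - e) < real_of_rat q" "real_of_rat q < t"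
      using of_rat_dense[of "max (- b) (t - e)" t] b(1) \<open>0 < e\<close> by auto
    moreover from this False have "\<not> 0 \<le> real_of_rat q" by linarith
    ultimately show ?thesis
      using b(2)[of "- real_of_rat q"] False by (intro exI[of _ q]) (auto simp: two_sided_def)
  qed
qed

text \<open>
  A counting path that takes every value makes only jumps of size one and is unbounded. A skipped
  index could hide the minimum of the walk from the process.
\<close>
definition exhaustive :: "(real \<Rightarrow> nat) \<Rightarrow> bool" where
  "exhaustive n \<longleftrightarrow> (\<forall>k. \<exists>t\<ge>0. n t = k)"

lemma sublevel_times_bounded:
  assumes n: "counting_path n" "exhaustive n"
    and lim: "filterlim (walk s) at_top sequentially"
  obtains T where "0 \<le> T" and "\<And>t. 0 \<le> t \<Longrightarrow> walk s (n t) \<le> 0 \<Longrightarrow> t \<le> T"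
proof -
  obtain I where I: "\<And>k. walk s k \<le> 0 \<Longrightarrow> k < I"
    using finite_sublevel[OF lim, of 0] by (auto simp: finite_nat_set_iff_bounded)
  obtain T where T: "0 \<le> T" "n T = I" using n(2) by (auto simp: exhaustive_def)
  have "t \<le> T" if "0 \<le> t" "walk s (n t) \<le> 0" for t
  proof (rule ccontr)
    assume "\<not> t \<le> T"
    then have "n T \<le> n t"
      using n(1) that(1) T(1) by (auto simp: counting_path_def mono_on_def)
    with I[OF that(2)] T(2) show False by simp
  qed
  with T(1) show ?thesis by (rule that)
qed

locale two_sided_path =
  fixes n1 n2 :: "real \<Rightarrow> nat" and s s' :: "nat \<Rightarrow> real"
  assumes counting: "counting_path n1" "counting_path n2"
    and exhaustive: "exhaustive n1" "exhaustive n2"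
    and lim: "filterlim (walk s) at_top sequentially" "filterlim (walk s') at_top sequentially"
begin

abbreviation v :: "real \<Rightarrow> real" where "v \<equiv> two_sided n1 n2 s s'"

definition minimizers :: "real set" where
  "minimizers = {t. is_arg_min v (\<lambda>_. True) t}"

lemma v_right: "0 \<le> t \<Longrightarrow> v t = walk s (n1 t)"
  by (simp add: two_sided_def)

lemma v_left: "0 \<le> t \<Longrightarrow> v (- t) = walk s' (n2 t)"
  using counting by (auto simp: two_sided_def counting_path_def)

text \<open>
  As no index is skipped, being minimal among the values of the process means being minimal among
  all partial sums on both sides.
\<close>
lemma minimizers_iff:
  "t \<in> minimizers \<longleftrightarrow> (\<forall>i. v t \<le> walk s i) \<and> (\<forall>i. v t \<le> walk s' i)"
proof
  assume "t \<in> minimizers"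
  then have min: "v t \<le> v u" for u by (auto simp: minimizers_def is_arg_min_def not_less)
  show "(\<forall>i. v t \<le> walk s i) \<and> (\<forall>i. v t \<le> walk s' i)"
    using exhaustive min v_right v_left unfolding exhaustive_def by metis
next
  assume "(\<forall>i. v t \<le> walk s i) \<and> (\<forall>i. v t \<le> walk s' i)"
  then show "t \<in> minimizers"
    by (auto simp: minimizers_def is_arg_min_def two_sided_def not_less)
qed

lemma minimizers_nonempty: "minimizers \<noteq> {}"
proof -
  obtain j where "last_min s j" using last_min_exists[OF lim(1)] .
  then have j: "walk s j \<le> walk s i" for i
    by (cases "i \<le> j") (auto simp: last_min_def intro: less_imp_le)
  obtain j' where "last_min s' j'" using last_min_exists[OF lim(2)] .
  then have j': "walk s' j' \<le> walk s' i" for i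
    by (cases "i \<le> j'") (auto simp: last_min_def intro: less_imp_le)
  obtain t t' where t: "0 \<le> t" "n1 t = j" "0 \<le> t'" "n2 t' = j'"
    using exhaustive unfolding exhaustive_def by meson
  have "t \<in> minimizers \<or> - t' \<in> minimizers"
    using j j' t v_right[of t] v_left[of t'] unfolding minimizers_iff
    by (metis linear order_trans)
  then show ?thesis by auto
qed

lemma minimizers_bounded: "bdd_above minimizers" "bdd_below minimizers"
proof -
  have nonpos: "v t \<le> 0" if "t \<in> minimizers" for t
    using that walk_0 unfolding minimizers_iff by metis
  obtain T where T: "0 \<le> T" "\<And>t. 0 \<le> t \<Longrightarrow> walk s (n1 t) \<le> 0 \<Longrightarrow> t \<le> T"
    using sublevel_times_bounded[OF counting(1) exhaustive(1) lim(1)] by blast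
  show "bdd_above minimizers"
  proof (rule bdd_aboveI)
    fix t assume "t \<in> minimizers"
    with nonpos[of t] T v_right[of t] show "t \<le> T" by (cases "0 \<le> t") auto
  qed
  obtain T' where T': "0 \<le> T'" "\<And>t. 0 \<le> t \<Longrightarrow> walk s' (n2 t) \<le> 0 \<Longrightarrow> t \<le> T'"
    using sublevel_times_bounded[OF counting(2) exhaustive(2) lim(2)] by blast
  show "bdd_below minimizers"
  proof (rule bdd_belowI)
    fix t assume "t \<in> minimizers"
    with nonpos[of t] T'(1) T'(2)[of "- t"] v_left[of "- t"] show "- T' \<le> t"
      by (cases "0 \<le> t") auto
  qed
qed

lemma mid_argmin_le_Sup: "mid_argmin v \<le> Sup minimizers"
  and Inf_le_mid_argmin: "Inf minimizers \<le> mid_argmin v"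
  using cInf_le_cSup[OF minimizers_nonempty minimizers_bounded]
  by (auto simp: mid_argmin_def minimizers_def)

text \<open>
  Some minimizer \<open>t\<close> lies beyond \<open>x\<close>. The walk is minimal at index \<open>n1 t\<close>, which therefore does
  not exceed the last index with this property.
\<close>
lemma last_min_after_mid_argmin:
  assumes "0 \<le> x" and "x < mid_argmin v"
  obtains n where "last_min s n" and "n1 x \<le> n"
proof -
  obtain t where t: "t \<in> minimizers" "x < t"
    using less_le_trans[OF assms(2) mid_argmin_le_Sup]
      less_cSup_iff[OF minimizers_nonempty minimizers_bounded(1)] by auto
  obtain n where n: "last_min s n" using last_min_exists[OF lim(1)] .
  have "walk s (n1 t) \<le> walk s n"
    using t assms(1) v_right[of t] by (simp add: minimizers_iff)
  then have "n1 t \<le> n"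
    using n by (auto simp: last_min_def intro: leI)
  moreover have "n1 x \<le> n1 t"
    using counting(1) t(2) assms(1) by (auto simp: counting_path_def mono_on_def)
  ultimately show ?thesis using that n by auto
qed

text \<open>
  The value at index \<open>Suc n\<close> undercuts everything that the process has seen on the left and up to
  time \<open>y\<close> on the right.
\<close>
lemma mid_argmin_ge:
  assumes "0 \<le> y" and "n1 y \<le> n"
    and right: "\<And>i. i \<le> n \<Longrightarrow> - K \<le> walk s i"
    and deep: "walk s (Suc n) < - K"
    and left: "\<And>i. - K \<le> walk s' i"
  shows "y \<le> mid_argmin v"
proof -
  have "y \<le> t" if t: "t \<in> minimizers" for t
  proof (rule ccontr)
    assume "\<not> y \<le> t"
    have "v t < - K"
      using t deep unfolding minimizers_iff by (meson le_less_trans)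
    moreover have "- K \<le> v t"
    proof (cases "0 \<le> t")
      case True
      then have "n1 t \<le> n1 y"
        using counting(1) \<open>\<not> y \<le> t\<close> by (auto simp: counting_path_def mono_on_def)
      then show ?thesis using right[of "n1 t"] \<open>n1 y \<le> n\<close> v_right[OF True] by simp
    next
      case False
      then show ?thesis using left by (simp add: two_sided_def)
    qed
    ultimately show False by simp
  qed
  then have "y \<le> Inf minimizers" by (intro cInf_greatest minimizers_nonempty)
  then show ?thesis using Inf_le_mid_argmin by (rule order_trans)
qed

end

section \<open>Poisson processes\<close>

text \<open>
  Exponential change of measure: the Poisson weights of intensity \<open>m\<close> are those of intensity
  \<open>m * z\<close>, multiplied by \<open>exp (m * (z - 1)) * (1 / z) ^ k\<close>. All Chernoff bounds below are instances.
\<close>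
lemma measure_poisson_pmf_le:
  assumes m: "0 < m" and z: "0 < z" and c: "0 \<le> c" "\<And>k. k \<in> A \<Longrightarrow> (1 / z) ^ k \<le> c"
  shows "measure (measure_pmf (poisson_pmf m)) A \<le> exp (m * (z - 1)) * c"
proof -
  let ?C = "exp (m * (z - 1)) * c"
  have mz: "0 < m * z" using m z by simp
  have le: "pmf (poisson_pmf m) k \<le> ?C * pmf (poisson_pmf (m * z)) k" if "k \<in> A" for k
  proof -
    have "exp (- m) = exp (m * (z - 1)) * exp (- (m * z))"
      by (simp add: algebra_simps flip: exp_add)
    moreover have "m ^ k = (1 / z) ^ k * (m * z) ^ k"
      using z by (simp add: power_mult_distrib power_divide)
    ultimately have "pmf (poisson_pmf m) k = exp (m * (z - 1)) * (1 / z) ^ k * pmf (poisson_pmf (m * z)) k"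
      using m mz by simp
    also have "\<dots> \<le> ?C * pmf (poisson_pmf (m * z)) k"
      using c(2)[OF that] by (intro mult_right_mono mult_left_mono) auto
    finally show ?thesis .
  qed
  have "emeasure (measure_pmf (poisson_pmf m)) A = (\<integral>\<^sup>+k. pmf (poisson_pmf m) k \<partial>count_space A)"
    by (simp only: nn_integral_pmf)
  also have "\<dots> \<le> (\<integral>\<^sup>+k. ennreal ?C * pmf (poisson_pmf (m * z)) k \<partial>count_space A)"
    using le c(1) by (intro nn_integral_mono) (simp add: ennreal_leI flip: ennreal_mult del: pmf_poisson)
  also have "\<dots> = ennreal ?C * emeasure (measure_pmf (poisson_pmf (m * z))) A"
    by (simp add: nn_integral_cmult nn_integral_pmf del: pmf_poisson)
  also have "\<dots> \<le> ennreal ?C * 1"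
    by (intro mult_left_mono measure_pmf.emeasure_le_1) simp
  finally show ?thesis
    using c(1) by (simp add: measure_pmf.emeasure_eq_measure)
qed

context prob_space
begin

lemma AE_not_in_of_prob_le_0:
  assumes "E \<in> events" and "prob E \<le> 0"
  shows "AE \<omega> in M. \<omega> \<notin> E"
proof (rule AE_not_in, rule null_setsI)
  show "emeasure M E = 0"
    using assms(2) measure_nonneg[of M E] by (simp add: emeasure_eq_measure)
qed (rule assms(1))

lemma poisson_process_measurable:
  assumes "poisson_process M r N" and "0 \<le> t"
  shows "N t \<in> measurable M (count_space UNIV)"
  using assms by (auto simp: poisson_process_def)

lemma prob_poisson_increment:
  assumes N: "poisson_process M r N" and st: "0 \<le> s" "s < t"
  shows "prob {\<omega> \<in> space M. N t \<omega> - N s \<omega> \<in> A} = measure (measure_pmf (poisson_pmf (r * (t - s)))) A"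
proof -
  have [measurable]: "N t \<in> measurable M (count_space UNIV)" "N s \<in> measurable M (count_space UNIV)"
    using poisson_process_measurable[OF N] st by auto
  have "measure (distr M (count_space UNIV) (\<lambda>\<omega>. N t \<omega> - N s \<omega>)) A =
      prob ((\<lambda>\<omega>. N t \<omega> - N s \<omega>) -` A \<inter> space M)"
    by (rule measure_distr) auto
  moreover have "distr M (count_space UNIV) (\<lambda>\<omega>. N t \<omega> - N s \<omega>) = measure_pmf (poisson_pmf (r * (t - s)))"
    using N st by (auto simp: poisson_process_def)
  ultimately show ?thesis
    by (simp add: vimage_def Int_def conj_commute)
qed

lemma prob_poisson_count:
  assumes N: "poisson_process M r N" and t: "0 < t"
  shows "prob {\<omega> \<in> space M. N t \<omega> \<in> A} = measure (measure_pmf (poisson_pmf (r * t))) A"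
proof -
  have "{\<omega> \<in> space M. N t \<omega> \<in> A} = {\<omega> \<in> space M. N t \<omega> - N 0 \<omega> \<in> A}"
    using N by (auto simp: poisson_process_def)
  then show ?thesis using prob_poisson_increment[OF N, of 0 t A] t by simp
qed

lemma prob_poisson_count_le:
  assumes N: "poisson_process M r N" and t: "0 < t" and z: "0 < z" "z \<le> 1"
  shows "prob {\<omega> \<in> space M. N t \<omega> \<le> n} \<le> exp (r * t * (z - 1)) * (1 / z) ^ n"
proof -
  have "0 < r * t" using N t by (simp add: poisson_process_def)
  then have "measure (measure_pmf (poisson_pmf (r * t))) {..n} \<le> exp (r * t * (z - 1)) * (1 / z) ^ n"
    using z by (intro measure_poisson_pmf_le power_increasing) auto
  then show ?thesis using prob_poisson_count[OF N t, of "{..n}"] by simp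
qed

lemma prob_poisson_count_ge:
  assumes N: "poisson_process M r N" and t: "0 < t" and z: "1 \<le> z"
  shows "prob {\<omega> \<in> space M. n \<le> N t \<omega>} \<le> exp (r * t * (z - 1)) * (1 / z) ^ n"
proof -
  have "0 < r * t" using N t by (simp add: poisson_process_def)
  then have "measure (measure_pmf (poisson_pmf (r * t))) {n..} \<le> exp (r * t * (z - 1)) * (1 / z) ^ n"
    using z by (intro measure_poisson_pmf_le power_decreasing) auto
  then show ?thesis using prob_poisson_count[OF N t, of "{n..}"] by simp
qed

text \<open>
  The Chernoff bound with tilting factor \<open>z = 1 / m\<close>, where \<open>m\<close> is the mean of the increment.
\<close>
lemma prob_poisson_double_jump_le:
  assumes N: "poisson_process M r N" and st: "0 \<le> s" "s < t" and small: "r * (t - s) \<le> 1"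
  shows "prob {\<omega> \<in> space M. 2 \<le> N t \<omega> - N s \<omega>} \<le> exp 1 * (r * (t - s))\<^sup>2"
proof -
  define m where "m = r * (t - s)"
  have m: "0 < m" "m \<le> 1" using N st small by (auto simp: m_def poisson_process_def)
  have "measure (measure_pmf (poisson_pmf m)) {2..} \<le> exp (m * (1 / m - 1)) * m\<^sup>2"
    using m by (intro measure_poisson_pmf_le) (auto intro: power_decreasing)
  also have "\<dots> \<le> exp 1 * m\<^sup>2"
    using m by (intro mult_right_mono) (auto simp: algebra_simps)
  finally show ?thesis
    using prob_poisson_increment[OF N st, of "{2..}"] by (simp add: m_def)
qed

lemma AE_poisson_unbounded:
  assumes N: "poisson_process M r N"
  shows "AE \<omega> in M. \<forall>k. \<exists>T::nat. k < N (real T) \<omega>"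
proof -
  have [measurable]: "N (real T) \<in> measurable M (count_space UNIV)" for T
    using poisson_process_measurable[OF N] by simp
  have r: "0 < r" using N by (simp add: poisson_process_def)
  have "AE \<omega> in M. \<exists>T::nat. k < N (real T) \<omega>" for k
  proof -
    let ?E = "{\<omega> \<in> space M. \<forall>T::nat. N (real T) \<omega> \<le> k}"
    have E: "?E \<in> sets M" by measurable
    have bound: "prob ?E \<le> exp (- (r / 2)) ^ Suc T * 2 ^ k" for T
    proof -
      have "prob ?E \<le> prob {\<omega> \<in> space M. N (real (Suc T)) \<omega> \<le> k}"
      proof (rule finite_measure_mono)
        show "?E \<subseteq> {\<omega> \<in> space M. N (real (Suc T)) \<omega> \<le> k}" by blast
      qed measurable
      also have "\<dots> \<le> exp (r * real (Suc T) * (1 / 2 - 1)) * (1 / (1 / 2)) ^ k"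
        by (rule prob_poisson_count_le[OF N]) auto
      also have "r * real (Suc T) * (1 / 2 - 1) = real (Suc T) * (- (r / 2))"
        by (simp add: algebra_simps)
      finally show ?thesis by (simp only: exp_of_nat_mult) simp
    qed
    have lim: "(\<lambda>T. exp (- (r / 2)) ^ Suc T * 2 ^ k) \<longlonglongrightarrow> 0"
      using r by (intro tendsto_mult_left_zero LIMSEQ_Suc[OF LIMSEQ_power_zero]) simp
    have "prob ?E \<le> 0"
      by (rule LIMSEQ_le_const[OF lim]) (use bound in blast)
    then have "AE \<omega> in M. \<omega> \<notin> ?E" by (rule AE_not_in_of_prob_le_0[OF E])
    then show ?thesis
      using AE_space by eventually_elim (auto simp: not_le)
  qed
  then show ?thesis by (simp add: AE_all_countable)
qed

end

text \<open>
  A discrete intermediate value theorem.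
\<close>
lemma unit_steps_attain:
  fixes f :: "nat \<Rightarrow> nat"
  assumes "f 0 = 0" and "\<And>j. j < m \<Longrightarrow> f (Suc j) - f j < 2" and "j \<le> m" and "k \<le> f j"
  shows "\<exists>i\<le>j. f i = k"
  using assms(3,4)
proof (induction j)
  case (Suc j)
  show ?case
  proof (cases "k \<le> f j")
    case True
    with Suc show ?thesis by (meson Suc_leD le_SucI)
  next
    case False
    with assms(2)[of j] Suc.prems have "f (Suc j) = k" by auto
    then show ?thesis by blast
  qed
qed (use assms(1) in auto)

context prob_space
begin

text \<open>
  With \<open>m\<close> grid intervals, the probability that some increment is at least 2 is of order
  \<open>m * (1 / m)\<^sup>2\<close>. So almost surely some grid separates all jumps, which gives
  \<open>AE_poisson_exhaustive\<close> without any analysis of jump times.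
\<close>
lemma AE_poisson_grid:
  assumes N: "poisson_process M r N" and T: "0 < T"
  shows "AE \<omega> in M. \<exists>m. \<forall>j<Suc m.
    N (real (Suc j) * (T / real (Suc m))) \<omega> - N (real j * (T / real (Suc m))) \<omega> < 2"
proof -
  define h where "h m = T / real (Suc m)" for m
  have h: "0 < h m" for m using T by (simp add: h_def)
  have [measurable]: "N (real j * h m) \<in> measurable M (count_space UNIV)" for j m
    using poisson_process_measurable[OF N] h[of m] by simp
  have r: "0 < r" using N by (simp add: poisson_process_def)
  let ?J = "\<lambda>m j. {\<omega> \<in> space M. 2 \<le> N (real (Suc j) * h m) \<omega> - N (real j * h m) \<omega>}"
  let ?E = "{\<omega> \<in> space M. \<forall>m. \<exists>j<Suc m. 2 \<le> N (real (Suc j) * h m) \<omega> - N (real j * h m) \<omega>}"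
  have E: "?E \<in> sets M" by measurable
  have bound: "prob ?E \<le> exp 1 * (r * T)\<^sup>2 / real (Suc m)" if m: "r * T \<le> real (Suc m)" for m
  proof -
    have J: "?J m j \<in> sets M" for j by measurable
    have "prob ?E \<le> prob (\<Union>j<Suc m. ?J m j)"
      using J by (intro finite_measure_mono sets.finite_UN) auto
    also have "\<dots> \<le> (\<Sum>j<Suc m. prob (?J m j))"
      using J by (intro measure_UNION_le) auto
    also have "\<dots> \<le> (\<Sum>j<Suc m. exp 1 * (r * h m)\<^sup>2)"
    proof (rule sum_mono)
      fix j
      have "r * h m \<le> 1" using m by (simp add: h_def)
      moreover have d: "real (Suc j) * h m - real j * h m = h m" by (simp add: algebra_simps)
      ultimately show "prob (?J m j) \<le> exp 1 * (r * h m)\<^sup>2"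
        using prob_poisson_double_jump_le[OF N, of "real j * h m" "real (Suc j) * h m"] h[of m]
        unfolding d by (simp add: algebra_simps)
    qed
    also have "\<dots> = exp 1 * (r * T)\<^sup>2 / real (Suc m)"
    proof -
      have "real n * (exp 1 * (r * (T / real n))\<^sup>2) = exp 1 * (r * T)\<^sup>2 / real n" if "0 < n" for n
        using that by (simp add: power2_eq_square field_simps)
      from this[of "Suc m"] show ?thesis by (simp add: h_def)
    qed
    finally show ?thesis .
  qed
  have "(\<lambda>m. exp 1 * (r * T)\<^sup>2 / real (Suc m)) \<longlonglongrightarrow> 0"
    by (rule LIMSEQ_Suc[OF lim_const_over_n])
  moreover have "\<forall>\<^sub>F m in sequentially. r * T \<le> real (Suc m)"
    by (rule eventually_sequentiallyI[of "nat \<lceil>r * T\<rceil>"]) linarith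
  then have "\<forall>\<^sub>F m in sequentially. prob ?E \<le> exp 1 * (r * T)\<^sup>2 / real (Suc m)"
    by eventually_elim (rule bound)
  ultimately have "prob ?E \<le> 0"
    by (intro tendsto_lowerbound) auto
  then have "AE \<omega> in M. \<omega> \<notin> ?E" by (rule AE_not_in_of_prob_le_0[OF E])
  then show ?thesis
    using AE_space
  proof eventually_elim
    case (elim \<omega>)
    then obtain m where "\<forall>j<Suc m. \<not> 2 \<le> N (real (Suc j) * h m) \<omega> - N (real j * h m) \<omega>"
      by blast
    then show ?case unfolding h_def not_le by blast
  qed
qed

lemma AE_poisson_exhaustive:
  assumes N: "poisson_process M r N"
  shows "AE \<omega> in M. exhaustive (\<lambda>t. N t \<omega>)"
proof -
  have "AE \<omega> in M. \<forall>T::nat. \<exists>m. \<forall>j<Suc m.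
    N (real (Suc j) * (real (Suc T) / real (Suc m))) \<omega> - N (real j * (real (Suc T) / real (Suc m))) \<omega> < 2"
    unfolding AE_all_countable by (intro allI AE_poisson_grid[OF N]) simp
  with AE_poisson_unbounded[OF N] AE_space show ?thesis
  proof eventually_elim
    case (elim \<omega>)
    show ?case unfolding exhaustive_def
    proof
      fix k
      obtain T0 :: nat where "k < N (real T0) \<omega>" using elim(1) by blast
      moreover have "N 0 \<omega> = 0" using N elim(2) by (simp add: poisson_process_def)
      ultimately obtain T where T: "k < N (real (Suc T)) \<omega>" by (cases T0) auto
      obtain m where m: "\<forall>j<Suc m.
          N (real (Suc j) * (real (Suc T) / real (Suc m))) \<omega> - N (real j * (real (Suc T) / real (Suc m))) \<omega> < 2"
        using elim(3) by blast
      let ?f = "\<lambda>j. N (real j * (real (Suc T) / real (Suc m))) \<omega>"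
      have "\<exists>i\<le>Suc m. ?f i = k"
      proof (rule unit_steps_attain)
        show "?f 0 = 0" using \<open>N 0 \<omega> = 0\<close> by simp
        show "?f (Suc j) - ?f j < 2" if "j < Suc m" for j using m that by blast
        show "k \<le> ?f (Suc m)" using T by simp
      qed simp
      then obtain i where "?f i = k" by blast
      then show "\<exists>t\<ge>0. N t \<omega> = k" by (intro exI[of _ "real i * (real (Suc T) / real (Suc m))"]) auto
    qed
  qed
qed

end

lemma counting_path_poisson:
  assumes "poisson_process M r N" and "\<omega> \<in> space M"
  shows "counting_path (\<lambda>t. N t \<omega>)"
  using assms by (auto simp: poisson_process_def counting_path_def)

section \<open>The two-sided compound Poisson process\<close>

text \<open>
  Connects the independence assumption, stated for the events generated by single jumps, with
  events about the whole jump sequence.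
\<close>
lemma generated_events_path:
  fixes Z :: "nat \<Rightarrow> 'a \<Rightarrow> real"
  assumes B: "B \<in> sets (\<Pi>\<^sub>M i\<in>UNIV. borel)"
  shows "{\<omega> \<in> space M. (\<lambda>i. Z i \<omega>) \<in> B} \<in> generated_events M borel UNIV Z"
proof -
  let ?G = "\<Union>i\<in>UNIV. {Z i -` A \<inter> space M | A. A \<in> sets (borel :: real measure)}"
  have G: "?G \<subseteq> Pow (space M)" by auto
  have "Z i \<in> borel_measurable (sigma (space M) ?G)" for i
    by (rule measurableI) (use G in \<open>auto simp: sets_measure_of space_measure_of\<close>)
  then have "(\<lambda>\<omega> i. Z i \<omega>) \<in> measurable (sigma (space M) ?G) (\<Pi>\<^sub>M i\<in>UNIV. borel)"
    by (intro measurable_PiM_single') (auto simp: PiE_UNIV_domain)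
  from measurable_sets[OF this B] have "(\<lambda>\<omega> i. Z i \<omega>) -` B \<inter> space M \<in> sigma_sets (space M) ?G"
    using G by (simp add: sets_measure_of space_measure_of)
  then show ?thesis
    by (simp add: generated_events_def vimage_def Int_def conj_commute)
qed

locale two_sided_cpp = prob_space M + W: drift_walk D for M :: "'a measure" and D +
  fixes r :: real and N1 N2 :: "real \<Rightarrow> 'a \<Rightarrow> nat" and Z Z' :: "nat \<Rightarrow> 'a \<Rightarrow> real"
    and V :: "real \<Rightarrow> 'a \<Rightarrow> real"
  assumes poisson: "poisson_process M r N1" "poisson_process M r N2"
    and iid: "iid_copies M D Z" "iid_copies M D Z'"
    and indep: "indep_sets
          (\<lambda>k. [generated_events M (count_space UNIV) {0..} N1,
                generated_events M (count_space UNIV) {0..} N2,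
                generated_events M borel UNIV Z,
                generated_events M borel UNIV Z'] ! k) {..<4}"
    and V: "\<And>\<omega> t. \<omega> \<in> space M \<Longrightarrow>
        V t \<omega> = two_sided (\<lambda>t. N1 t \<omega>) (\<lambda>t. N2 t \<omega>) (\<lambda>i. Z i \<omega>) (\<lambda>i. Z' i \<omega>) t"
begin

lemma rate_pos: "0 < r"
  using poisson(1) by (simp add: poisson_process_def)

lemmas jumps_measurable =
  W.iid_copies_measurable[OF prob_space_axioms iid(1)]
  W.iid_copies_measurable[OF prob_space_axioms iid(2)]

lemma prob_jumps:
  assumes "B \<in> sets W.S"
  shows "prob {\<omega> \<in> space M. (\<lambda>i. Z i \<omega>) \<in> B} = W.prob B"
    "prob {\<omega> \<in> space M. (\<lambda>i. Z' i \<omega>) \<in> B} = W.prob B"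
  using measure_distr[OF jumps_measurable(1) assms] measure_distr[OF jumps_measurable(2) assms]
    distr_iid_copies[OF iid(1)] distr_iid_copies[OF iid(2)]
  by (simp_all add: vimage_def Int_def conj_commute)

lemma prob_count_and_jumps:
  assumes "0 \<le> t" and B: "B \<in> sets W.S" and B': "B' \<in> sets W.S"
  shows "prob {\<omega> \<in> space M. N1 t \<omega> \<le> n \<and> (\<lambda>i. Z i \<omega>) \<in> B \<and> (\<lambda>i. Z' i \<omega>) \<in> B'} =
    prob {\<omega> \<in> space M. N1 t \<omega> \<le> n} * W.prob B * W.prob B'"
proof -
  \<comment> \<open>Position 1 of the list belongs to the left clock, which does not occur in the event.\<close>
  let ?E = "{\<omega> \<in> space M. N1 t \<omega> \<le> n}" and ?F = "{\<omega> \<in> space M. (\<lambda>i. Z i \<omega>) \<in> B}"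
    and ?F' = "{\<omega> \<in> space M. (\<lambda>i. Z' i \<omega>) \<in> B'}"
  have "?E = N1 t -` {..n} \<inter> space M" by auto
  then have E: "?E \<in> generated_events M (count_space UNIV) {0..} N1"
    using \<open>0 \<le> t\<close> unfolding generated_events_def by (intro sigma_sets.Basic) auto
  have F: "?F \<in> generated_events M borel UNIV Z" "?F' \<in> generated_events M borel UNIV Z'"
    using B B' by (auto intro!: generated_events_path simp: W.sets_S)
  have "prob (\<Inter>j\<in>{0, 2, 3}. [?E, {}, ?F, ?F'] ! j) = (\<Prod>j\<in>{0, 2, 3}. prob ([?E, {}, ?F, ?F'] ! j))"
    using E F by (intro indep_setsD[OF indep]) (auto simp: numeral_eq_Suc)
  also have "(\<Inter>j\<in>{0, 2, 3}. [?E, {}, ?F, ?F'] ! j) =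
      {\<omega> \<in> space M. N1 t \<omega> \<le> n \<and> (\<lambda>i. Z i \<omega>) \<in> B \<and> (\<lambda>i. Z' i \<omega>) \<in> B'}"
    by (auto simp: numeral_eq_Suc)
  also have "(\<Prod>j\<in>{0, 2, 3}. prob ([?E, {}, ?F, ?F'] ! j)) = prob ?E * W.prob B * W.prob B'"
    using prob_jumps(1)[OF B] prob_jumps(2)[OF B'] by (simp add: numeral_eq_Suc)
  finally show ?thesis .
qed

lemma AE_two_sided_path:
  "AE \<omega> in M. two_sided_path (\<lambda>t. N1 t \<omega>) (\<lambda>t. N2 t \<omega>) (\<lambda>i. Z i \<omega>) (\<lambda>i. Z' i \<omega>)"
proof -
  have "AE \<omega> in M. filterlim (walk (\<lambda>i. Z i \<omega>)) at_top sequentially"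
    by (rule AE_distrD[OF jumps_measurable(1)], subst distr_iid_copies[OF iid(1)],
        rule W.AE_walk_at_top)
  moreover have "AE \<omega> in M. filterlim (walk (\<lambda>i. Z' i \<omega>)) at_top sequentially"
    by (rule AE_distrD[OF jumps_measurable(2)], subst distr_iid_copies[OF iid(2)],
        rule W.AE_walk_at_top)
  ultimately show ?thesis
    using AE_poisson_exhaustive[OF poisson(1)] AE_poisson_exhaustive[OF poisson(2)] AE_space
  proof eventually_elim
    case (elim \<omega>)
    then show ?case
      by (intro two_sided_path.intro counting_path_poisson[OF poisson(1)]
          counting_path_poisson[OF poisson(2)])
  qed
qed

lemma V_measurable: "V t \<in> borel_measurable M"
proof -
  have Y [measurable]: "Z i \<in> borel_measurable M" "Z' i \<in> borel_measurable M" for i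
    using iid by (auto simp: iid_copies_def indep_vars_def)
  have eq: "V t \<omega> = (if 0 \<le> t then \<Sum>i<N1 t \<omega>. Z i \<omega> else \<Sum>i<N2 (- t) \<omega>. Z' i \<omega>)"
    if "\<omega> \<in> space M" for \<omega>
    using V[OF that] by (simp add: two_sided_def walk_def)
  show ?thesis
  proof (cases "0 \<le> t")
    case True
    then have [measurable]: "N1 t \<in> measurable M (count_space UNIV)"
      by (rule poisson_process_measurable[OF poisson(1)])
    have "(\<lambda>\<omega>. \<Sum>i<N1 t \<omega>. Z i \<omega>) \<in> borel_measurable M"
      by (rule measurable_compose_countable[where g="N1 t" and f="\<lambda>n \<omega>. \<Sum>i<n. Z i \<omega>"]) measurable
    with True show ?thesis by (simp add: eq cong: measurable_cong)
  next
    case False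
    then have [measurable]: "N2 (- t) \<in> measurable M (count_space UNIV)"
      by (intro poisson_process_measurable[OF poisson(2)]) simp
    have "(\<lambda>\<omega>. \<Sum>i<N2 (- t) \<omega>. Z' i \<omega>) \<in> borel_measurable M"
      by (rule measurable_compose_countable[where g="N2 (- t)" and f="\<lambda>n \<omega>. \<Sum>i<n. Z' i \<omega>"]) measurable
    with False show ?thesis by (simp add: eq cong: measurable_cong)
  qed
qed

lemma mid_argmin_measurable: "(\<lambda>\<omega>. mid_argmin (\<lambda>t. V t \<omega>)) \<in> borel_measurable M"
proof (rule borel_measurable_mid_argmin[OF V_measurable])
  fix \<omega> assume \<omega>: "\<omega> \<in> space M"
  show "rationally_traced (\<lambda>t. V t \<omega>)"
    unfolding V[OF \<omega>]
    by (intro rationally_traced_two_sided counting_path_poisson[OF poisson(1) \<omega>]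
        counting_path_poisson[OF poisson(2) \<omega>])
qed

lemma one_minus_prob_mid_argmin:
  "1 - prob {\<omega> \<in> space M. mid_argmin (\<lambda>t. V t \<omega>) \<le> x} = prob {\<omega> \<in> space M. x < mid_argmin (\<lambda>t. V t \<omega>)}"
proof -
  note [measurable] = mid_argmin_measurable
  have "prob {\<omega> \<in> space M. \<not> mid_argmin (\<lambda>t. V t \<omega>) \<le> x} =
      1 - prob {\<omega> \<in> space M. mid_argmin (\<lambda>t. V t \<omega>) \<le> x}"
    by (rule prob_neg) measurable
  then show ?thesis by (simp add: not_le)
qed

end

lemma two_sided_cpp_of_is_CPP:
  assumes "is_CPP M D r V" and "drift_walk D"
  obtains N1 N2 Z Z' where "two_sided_cpp M D r N1 N2 Z Z' V"
proof -
  from assms(1) obtain N1 N2 Z Z' where M: "prob_space M"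
    and rest: "poisson_process M r N1" "poisson_process M r N2"
        "iid_copies M D Z" "iid_copies M D Z'"
        "prob_space.indep_sets M
          (\<lambda>k. [generated_events M (count_space UNIV) {0..} N1,
                generated_events M (count_space UNIV) {0..} N2,
                generated_events M borel UNIV Z,
                generated_events M borel UNIV Z'] ! k) {..<4}"
        "\<forall>\<omega>\<in>space M. \<forall>t. V t \<omega> =
           (if 0 \<le> t then \<Sum>i<N1 t \<omega>. Z i \<omega> else \<Sum>i<N2 (- t) \<omega>. Z' i \<omega>)"
    unfolding is_CPP_def by blast
  have "two_sided_cpp M D r N1 N2 Z Z' V"
    using M assms(2) rest
    by (intro two_sided_cpp.intro two_sided_cpp_axioms.intro) (auto simp: two_sided_def walk_def)
  then show ?thesis by (rule that)
qed

section \<open>Tail bounds for the location of the minimum\<close>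

context drift_walk
begin

lemma expectation_abs_walk_le: "(\<integral>s. \<bar>walk s n\<bar> \<partial>S) \<le> real n * (\<integral>x. \<bar>x\<bar> \<partial>D)"
  and walk_integrable: "integrable S (\<lambda>s. walk s n)"
proof -
  have step: "integrable S (\<lambda>s. s i)" "(\<integral>s. \<bar>s i\<bar> \<partial>S) = (\<integral>x. \<bar>x\<bar> \<partial>D)" for i
  proof -
    show "integrable S (\<lambda>s. s i)"
      by (rule integrable_distr[OF step_measurable[of i]]) (simp only: distr_step step_integrable)
    show "(\<integral>s. \<bar>s i\<bar> \<partial>S) = (\<integral>x. \<bar>x\<bar> \<partial>D)"
      by (subst distr_step[of i, symmetric], subst integral_distr[OF step_measurable]) simp_all
  qed
  have int: "integrable S (\<lambda>s. walk s n)" for n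
    unfolding walk_def using step(1) by (rule Bochner_Integration.integrable_sum)
  then show "integrable S (\<lambda>s. walk s n)" .
  have "(\<integral>s. \<bar>walk s n\<bar> \<partial>S) \<le> (\<integral>s. (\<Sum>i<n. \<bar>s i\<bar>) \<partial>S)"
    using int[of n] step(1)
    by (intro integral_mono integrable_abs Bochner_Integration.integrable_sum)
      (auto simp: walk_def)
  also have "\<dots> = (\<Sum>i<n. \<integral>s. \<bar>s i\<bar> \<partial>S)"
    using step(1) by (intro Bochner_Integration.integral_sum integrable_abs)
  finally show "(\<integral>s. \<bar>walk s n\<bar> \<partial>S) \<le> real n * (\<integral>x. \<bar>x\<bar> \<partial>D)"
    by (simp add: step(2))
qed

text \<open>
  The strip has constant depth and linear height. The depth comes from the bound on the maximal
  fall, the height from Markov's inequality applied to \<open>\<bar>walk s n\<bar>\<close>.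
\<close>
lemma walk_strip:
  obtains K C where "0 < K" and "0 < C"
    and "3 / 4 \<le> prob {s. \<forall>i. - K \<le> walk s i}"
    and "\<And>n. 0 < n \<Longrightarrow> 1 / 2 \<le> prob {s. (\<forall>i\<le>n. - K \<le> walk s i) \<and> walk s n \<le> C * real n}"
proof -
  define K0 where "K0 = (\<integral>x. x\<^sup>2 \<partial>D) / (2 * drift)"
  \<comment> \<open>The factor 4 makes the failure probability at most one quarter; the summand 1 keeps \<open>K\<close> positive.\<close>
  define K where "K = 4 * K0 + 1"
  define E where "E = (\<integral>x. \<bar>x\<bar> \<partial>D)"
  have drift: "0 < drift" using drift_pos by (simp add: drift_def)
  have K0: "0 \<le> K0" using drift by (simp add: K0_def)
  then have K: "0 < K" by (simp add: K_def)
  have E: "0 < E"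
    using drift integral_mono[OF step_integrable integrable_abs[OF step_integrable] abs_ge_self]
    by (simp add: E_def drift_def)
  let ?L = "{s. \<exists>k. walk s k < - K}"
  have L_sets: "{s \<in> space S. \<exists>k. walk s k < - K} \<in> sets S" by measurable
  have "prob ?L \<le> K0 / K"
    using prob_below_line[OF drift K] by (simp add: K0_def)
  also have "\<dots> \<le> 1 / 4" using K K0 by (simp add: K_def field_simps)
  finally have L: "prob ?L \<le> 1 / 4" .
  have "prob {s. \<forall>i. - K \<le> walk s i} = prob (space S - ?L)"
    by (rule arg_cong[of _ _ prob]) (simp add: set_eq_iff, meson not_less)
  also have "\<dots> = 1 - prob ?L"
    using L_sets by (intro P.prob_compl) simp
  finally have left: "3 / 4 \<le> prob {s. \<forall>i. - K \<le> walk s i}" using L by simp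
  have right: "1 / 2 \<le> prob {s. (\<forall>i\<le>n. - K \<le> walk s i) \<and> walk s n \<le> 4 * E * real n}" if n: "0 < n" for n
  proof -
    let ?H = "{s \<in> space S. 4 * E * real n \<le> \<bar>walk s n\<bar>}"
    have H_sets: "?H \<in> sets S" by measurable
    have "prob ?H \<le> (\<integral>s. \<bar>walk s n\<bar> \<partial>S) / (4 * E * real n)"
      using n E
      by (intro integral_Markov_inequality_measure[where A="{}"] integrable_abs walk_integrable) auto
    also have "\<dots> \<le> real n * E / (4 * E * real n)"
      using expectation_abs_walk_le[of n] n E by (intro divide_right_mono) (auto simp: E_def)
    also have "\<dots> = 1 / 4" using n E by simp
    finally have H: "prob ?H \<le> 1 / 4" .
    have "prob (?L \<union> ?H) \<le> prob ?L + prob ?H"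
      using L_sets H_sets by (intro measure_Un_le) auto
    with L H have "prob (?L \<union> ?H) \<le> 1 / 2" by simp
    moreover have "prob (space S - (?L \<union> ?H)) = 1 - prob (?L \<union> ?H)"
      using L_sets H_sets by (intro P.prob_compl) auto
    moreover have "prob (space S - (?L \<union> ?H)) \<le>
        prob {s. (\<forall>i\<le>n. - K \<le> walk s i) \<and> walk s n \<le> 4 * E * real n}"
    proof (rule P.finite_measure_mono)
      have "{s \<in> space S. (\<forall>i\<le>n. - K \<le> walk s i) \<and> walk s n \<le> 4 * E * real n} \<in> sets S"
        by measurable
      then show "{s. (\<forall>i\<le>n. - K \<le> walk s i) \<and> walk s n \<le> 4 * E * real n} \<in> sets S" by simp
    qed (auto simp: not_less not_le)
    ultimately show ?thesis by linarith
  qed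
  show ?thesis
    by (rule that[OF K _ left right]) (use E in simp_all)
qed

text \<open>
  The step number \<open>n\<close> is independent of the walk up to that index, and from a height of at most \<open>c\<close>
  a step below \<open>- y\<close> leads below \<open>- K\<close>.
\<close>
lemma prob_deep_step_ge:
  assumes strip: "1 / 2 \<le> prob {s. (\<forall>i\<le>n. - K \<le> walk s i) \<and> walk s n \<le> c}" and y: "c + K \<le> y"
  shows "measure D {..< - y} / 2 \<le> prob {s. (\<forall>i\<le>n. - K \<le> walk s i) \<and> walk s (Suc n) < - K}"
proof -
  let ?A = "{s. (\<forall>i\<le>n. - K \<le> walk s i) \<and> walk s n \<le> c}" and ?B = "{s. s 0 < - y}"
  have A: "{s \<in> space S. (\<forall>i\<le>n. - K \<le> walk s i) \<and> walk s n \<le> c} \<in> sets S" by measurable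
  have "?B = (\<lambda>s. s 0) -` {..< - y} \<inter> space S" by auto
  then have B: "?B \<in> sets S" using measurable_sets[OF step_measurable[of 0], of "{..< - y}"] by simp
  have B_prob: "prob ?B = measure D {..< - y}"
    using measure_distr[OF step_measurable[of 0], of "{..< - y}"]
    by (simp add: distr_step vimage_def)
  have "measure D {..< - y} / 2 \<le> prob ?A * prob ?B"
    using mult_right_mono[OF strip, of "prob ?B"] by (simp add: B_prob)
  also have "\<dots> = prob {s. s \<in> ?A \<and> (\<lambda>j. s (n + j)) \<in> ?B}"
  proof (rule prob_block_shift[symmetric])
    fix s s' :: "nat \<Rightarrow> real" assume "\<And>i. i < n \<Longrightarrow> s i = s' i"
    then have "walk s i = walk s' i" if "i \<le> n" for i
      unfolding walk_def using that by (intro sum.cong) auto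
    then show "s \<in> ?A \<longleftrightarrow> s' \<in> ?A" by simp
  qed (use A B in simp_all)
  also have "\<dots> \<le> prob {s. (\<forall>i\<le>n. - K \<le> walk s i) \<and> walk s (Suc n) < - K}"
  proof (rule P.finite_measure_mono)
    have "{s \<in> space S. (\<forall>i\<le>n. - K \<le> walk s i) \<and> walk s (Suc n) < - K} \<in> sets S"
      by (simp only: walk_Suc) (measurable, auto intro: step_measurable)
    then show "{s. (\<forall>i\<le>n. - K \<le> walk s i) \<and> walk s (Suc n) < - K} \<in> sets S" by simp
  qed (use y in auto)
  finally show ?thesis .
qed

end

text \<open>
  With \<open>y = exp a\<close> the claim is \<open>y + 1 / y ^ 3 \<le> 2\<close>, which factorizes as
  \<open>0 \<le> (y - 1) * (1 + y + y\<^sup>2 - y ^ 3)\<close>; the second factor is positive for \<open>1 \<le> y \<le> 6 / 5\<close>.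
\<close>
lemma geometric_constant_le:
  fixes a :: real
  assumes "0 < a" and "a \<le> 1 / 8"
  shows "exp a - 1 \<le> 1 - exp (- (3 * a))"
proof -
  define y where "y = exp a"
  have y1: "1 < y" using assms by (simp add: y_def)
  have "y \<le> 1 + a + a\<^sup>2" unfolding y_def using assms by (intro exp_bound) auto
  also have "\<dots> \<le> 1 + 1 / 8 + (1 / 8)\<^sup>2"
    using assms by (intro add_mono power_mono) auto
  finally have y2: "y \<le> 6 / 5" by (simp add: power2_eq_square)
  have "y ^ 3 \<le> (6 / 5) ^ 3" using y1 y2 by (intro power_mono) auto
  also have "(6 / 5 :: real) ^ 3 \<le> 2" by (simp add: power3_eq_cube)
  finally have "y ^ 3 \<le> 2" .
  moreover have "1 \<le> y\<^sup>2" using y1 by simp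
  ultimately have "0 \<le> 1 + y + y\<^sup>2 - y ^ 3" using y1 by linarith
  then have "0 \<le> (y - 1) * (1 + y + y\<^sup>2 - y ^ 3)"
    using y1 by simp
  then have "y * y ^ 3 + 1 \<le> 2 * y ^ 3"
    by (simp add: algebra_simps power2_eq_square power3_eq_cube)
  then have "y + 1 / y ^ 3 \<le> 2"
    using y1 by (simp add: field_simps)
  moreover have "exp (- (3 * a)) = 1 / y ^ 3"
    unfolding y_def by (simp add: exp_minus inverse_eq_divide flip: exp_of_nat_mult)
  ultimately show ?thesis by (simp add: y_def)
qed

context two_sided_cpp
begin

text \<open>
  Outside a null set, a midpoint beyond \<open>x\<close> comes with an index \<open>n\<close> that is the last minimum of the
  right walk and that the clock has not passed at time \<open>x\<close>. The clock is independent of the walk,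
  and the two exponential bounds combine to a geometric series with ratio \<open>exp (- 3 a)\<close>.
\<close>
lemma prob_mid_argmin_gt_le:
  assumes x: "0 < x" and b: "0 < b" and bounded: "AE y in D. \<bar>y\<bar> \<le> b"
  defines "a \<equiv> W.drift\<^sup>2 / (8 * b\<^sup>2)"
  shows "prob {\<omega> \<in> space M. x < mid_argmin (\<lambda>t. V t \<omega>)} \<le>
    W.escape / (exp a - 1) * exp (- (x * r * (1 - exp (- a))))"
proof -
  have drift: "0 < W.drift" using W.drift_pos by (simp add: W.drift_def)
  have a: "0 < a" using drift b by (simp add: a_def)
  have "W.drift \<le> (\<integral>y. b \<partial>D)"
    unfolding W.drift_def using bounded W.step_integrable by (intro integral_mono_AE) auto
  then have "W.drift \<le> b" using W.M.prob_space by simp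
  then have "W.drift\<^sup>2 \<le> b\<^sup>2" using drift by (intro power_mono) auto
  then have a_le: "a \<le> 1 / 8" using b by (simp add: a_def field_simps)
  define E where "E n = {\<omega> \<in> space M. N1 x \<omega> \<le> n \<and> last_min (\<lambda>i. Z i \<omega>) n}" for n
  define c where "c = W.escape * exp (- (x * r * (1 - exp (- a))))"
  define q where "q = exp (- (3 * a))"
  have q: "0 < q" "q < 1" using a by (auto simp: q_def)
  have N1m [measurable]: "N1 x \<in> measurable M (count_space UNIV)"
    using poisson_process_measurable[OF poisson(1)] x by simp
  have L: "{s. last_min s n} \<in> sets W.S" for n
  proof -
    have "{s \<in> space W.S. last_min s n} \<in> sets W.S" by measurable
    then show ?thesis by simp
  qed
  have E_sets: "E n \<in> sets M" for n
  proof -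
    have "E n = {\<omega> \<in> space M. N1 x \<omega> \<le> n} \<inter> ((\<lambda>\<omega> i. Z i \<omega>) -` {s. last_min s n} \<inter> space M)"
      by (auto simp: E_def)
    also have "\<dots> \<in> sets M"
      by (intro sets.Int measurable_sets[OF jumps_measurable(1) L]) measurable
    finally show ?thesis .
  qed
  have E_prob: "prob (E n) \<le> c * q ^ n" for n
  proof -
    have "prob (E n) = prob {\<omega> \<in> space M. N1 x \<omega> \<le> n} * W.prob {s. last_min s n} * W.prob UNIV"
      using prob_count_and_jumps[of x "{s. last_min s n}" UNIV n] x L sets.top[of W.S] by (simp add: E_def)
    also have "W.prob UNIV = 1" using W.P.prob_space by simp
    also have "prob {\<omega> \<in> space M. N1 x \<omega> \<le> n} * W.prob {s. last_min s n} * 1 \<le>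
        (exp (r * x * (exp (- a) - 1)) * (1 / exp (- a)) ^ n) * (exp (- (4 * a)) ^ n * W.escape)"
    proof -
      have "W.prob {s. walk s n \<le> 0} \<le> exp (- (real n * W.drift\<^sup>2 / (2 * b\<^sup>2)))"
        by (rule W.prob_walk_nonpos_le[OF b bounded])
      also have "- (real n * W.drift\<^sup>2 / (2 * b\<^sup>2)) = real n * (- (4 * a))"
        using b by (simp add: a_def field_simps)
      finally have "W.prob {s. walk s n \<le> 0} \<le> exp (- (4 * a)) ^ n"
        by (simp only: exp_of_nat_mult)
      then have "W.prob {s. last_min s n} \<le> exp (- (4 * a)) ^ n * W.escape"
        using W.prob_last_min_le[of n] W.escape_pos
        by (meson less_imp_le mult_right_mono order_trans)
      moreover have "prob {\<omega> \<in> space M. N1 x \<omega> \<le> n} \<le> exp (r * x * (exp (- a) - 1)) * (1 / exp (- a)) ^ n"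
        using a by (intro prob_poisson_count_le[OF poisson(1) x]) auto
      ultimately show ?thesis
        unfolding mult_1_right by (intro mult_mono) auto
    qed
    also have "r * x * (exp (- a) - 1) = - (x * r * (1 - exp (- a)))"
      by (simp add: algebra_simps)
    also have "(exp (- (x * r * (1 - exp (- a)))) * (1 / exp (- a)) ^ n) * (exp (- (4 * a)) ^ n * W.escape) =
        c * ((1 / exp (- a)) * exp (- (4 * a))) ^ n"
      unfolding c_def power_mult_distrib by (simp only: mult_ac)
    also have "(1 / exp (- a)) * exp (- (4 * a)) = q"
      by (simp add: q_def exp_minus field_simps flip: exp_add)
    finally show ?thesis .
  qed
  have geo: "(\<lambda>n. c * q ^ n) sums (c * (1 / (1 - q)))"
    using q by (intro sums_mult geometric_sums) simp
  have E_summable: "summable (\<lambda>n. prob (E n))"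
    by (rule summable_comparison_test'[OF sums_summable[OF geo], of 0]) (use E_prob in auto)
  have "prob {\<omega> \<in> space M. x < mid_argmin (\<lambda>t. V t \<omega>)} \<le> prob (\<Union>n. E n)"
  proof (rule finite_measure_mono_AE)
    show "AE \<omega> in M. \<omega> \<in> {\<omega> \<in> space M. x < mid_argmin (\<lambda>t. V t \<omega>)} \<longrightarrow> \<omega> \<in> (\<Union>n. E n)"
      using AE_two_sided_path AE_space
    proof eventually_elim
      case (elim \<omega>)
      interpret two_sided_path "\<lambda>t. N1 t \<omega>" "\<lambda>t. N2 t \<omega>" "\<lambda>i. Z i \<omega>" "\<lambda>i. Z' i \<omega>"
        by (rule elim(1))
      show ?case
        using last_min_after_mid_argmin[of x] x elim(2) by (auto simp: V[OF elim(2)] E_def)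
    qed
  qed (use E_sets in auto)
  also have "\<dots> \<le> (\<Sum>n. prob (E n))"
    using E_sets E_summable by (intro finite_measure_subadditive_countably) auto
  also have "\<dots> \<le> (\<Sum>n. c * q ^ n)"
    using E_prob E_summable sums_summable[OF geo] by (intro suminf_le) auto
  also have "\<dots> = c / (1 - q)" using sums_unique[OF geo] by simp
  also have "\<dots> \<le> c / (exp a - 1)"
    using geometric_constant_le[OF a a_le] a W.escape_pos
    by (intro divide_left_mono mult_pos_pos) (auto simp: q_def c_def)
  finally show ?thesis by (simp add: c_def)
qed

text \<open>
  The right walk makes its deep step at an index \<open>n\<close> that the clock has, with probability at least
  one half, not passed at time \<open>x + 1\<close>. As \<open>n\<close> is linear in \<open>x\<close>, the required depth is at most
  \<open>d * x\<close> for a constant \<open>d\<close>.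
\<close>
lemma prob_mid_argmin_gt_ge:
  assumes c1: "0 < c1"
    and tail: "\<And>y. y0 \<le> y \<Longrightarrow> c1 * y powr - g \<le> measure D {..< - y}"
  shows "\<exists>k>0. \<exists>c>0. \<forall>x\<ge>k. c * x powr - g \<le> prob {\<omega> \<in> space M. x < mid_argmin (\<lambda>t. V t \<omega>)}"
proof -
  obtain K C where K: "0 < K" and C: "0 < C"
    and left: "3 / 4 \<le> W.prob {s. \<forall>i. - K \<le> walk s i}"
    and strip: "\<And>n. 0 < n \<Longrightarrow> 1 / 2 \<le> W.prob {s. (\<forall>i\<le>n. - K \<le> walk s i) \<and> walk s n \<le> C * real n}"
    using W.walk_strip by blast
  define d where "d = C * (4 * r + 1) + K"
  have d: "0 < d" using C K rate_pos by (simp add: d_def add_pos_pos)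
  define k where "k = max 1 (y0 / d)"
  define c where "c = 3 / 16 * c1 * d powr - g"
  have "c * x powr - g \<le> prob {\<omega> \<in> space M. x < mid_argmin (\<lambda>t. V t \<omega>)}" if "k \<le> x" for x
  proof -
    have x: "1 \<le> x" "y0 \<le> d * x"
      using that d by (auto simp: k_def field_simps)
    \<comment> \<open>Twice the mean number of clock ticks up to time \<open>x + 1\<close>. The extra unit of time turns the
      weak inequality of \<open>mid_argmin_ge\<close> into a strict one.\<close>
    define n where "n = nat \<lceil>2 * r * (x + 1)\<rceil>"
    have rx: "0 < r * (x + 1)" using rate_pos x by simp
    have n: "2 * r * (x + 1) \<le> real n" "real n \<le> 2 * r * (x + 1) + 1" "0 < n"
      using rx unfolding n_def by (linarith, linarith, simp)
    let ?N = "{\<omega> \<in> space M. N1 (x + 1) \<omega> \<le> n}"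
    let ?B = "{s. (\<forall>i\<le>n. - K \<le> walk s i) \<and> walk s (Suc n) < - K}"
    let ?B' = "{s. \<forall>i. - K \<le> walk s i}"
    let ?G = "{\<omega> \<in> space M. N1 (x + 1) \<omega> \<le> n \<and> (\<lambda>i. Z i \<omega>) \<in> ?B \<and> (\<lambda>i. Z' i \<omega>) \<in> ?B'}"
    have B: "?B \<in> sets W.S"
    proof -
      have "{s \<in> space W.S. (\<forall>i\<le>n. - K \<le> walk s i) \<and> walk s (Suc n) < - K} \<in> sets W.S"
        by (simp only: walk_Suc) (measurable, auto intro: W.step_measurable)
      then show ?thesis by simp
    qed
    have B': "?B' \<in> sets W.S"
    proof -
      have "{s \<in> space W.S. \<forall>i. - K \<le> walk s i} \<in> sets W.S" by measurable
      then show ?thesis by simp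
    qed
    have "prob ?N = 1 - prob {\<omega> \<in> space M. Suc n \<le> N1 (x + 1) \<omega>}"
    proof -
      have [measurable]: "N1 (x + 1) \<in> measurable M (count_space UNIV)"
        using poisson_process_measurable[OF poisson(1)] x by simp
      have "prob {\<omega> \<in> space M. \<not> Suc n \<le> N1 (x + 1) \<omega>} = 1 - prob {\<omega> \<in> space M. Suc n \<le> N1 (x + 1) \<omega>}"
        by (rule prob_neg) measurable
      then show ?thesis by (simp add: not_le less_Suc_eq_le)
    qed
    moreover have "prob {\<omega> \<in> space M. Suc n \<le> N1 (x + 1) \<omega>} \<le> 1 / 2"
    proof -
      have "prob {\<omega> \<in> space M. Suc n \<le> N1 (x + 1) \<omega>} \<le> exp (r * (x + 1) * (exp 1 - 1)) * (1 / exp 1) ^ Suc n"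
        using x by (intro prob_poisson_count_ge[OF poisson(1)]) auto
      also have "(1 / exp 1) ^ Suc n = exp (- real (Suc n))"
        using exp_of_nat_mult[of "Suc n" "- 1 :: real"] by (simp add: exp_minus inverse_eq_divide)
      also have "exp (r * (x + 1) * (exp 1 - 1)) * exp (- real (Suc n)) = exp (r * (x + 1) * (exp 1 - 1) - real (Suc n))"
        by (simp flip: exp_add)
      also have "\<dots> \<le> exp (- 1)"
      proof -
        have "r * (x + 1) * (exp 1 - 1) \<le> r * (x + 1) * 2"
          using exp_le rx by (intro mult_left_mono) auto
        then show ?thesis using n(1) by simp
      qed
      also have "exp (- 1 :: real) \<le> 1 / 2"
        using exp_ge_add_one_self[of 1] by (simp add: exp_minus field_simps)
      finally show ?thesis .
    qed
    ultimately have N: "1 / 2 \<le> prob ?N" by simp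
    have "C * real n + K \<le> d * x"
    proof -
      have "r \<le> r * x" using x rate_pos by simp
      then have "real n \<le> (4 * r + 1) * x"
        using n(2) x by (simp add: algebra_simps)
      then have "C * real n \<le> C * ((4 * r + 1) * x)" using C by simp
      moreover have "K \<le> K * x" using K x by simp
      ultimately show ?thesis by (simp add: d_def algebra_simps)
    qed
    then have "measure D {..< - (d * x)} / 2 \<le> W.prob ?B"
      by (rule W.prob_deep_step_ge[OF strip[OF n(3)]])
    with tail[OF x(2)] have Bp: "c1 * (d * x) powr - g / 2 \<le> W.prob ?B" by simp
    have "c * x powr - g = 1 / 2 * (c1 * (d * x) powr - g / 2) * (3 / 4)"
      using d x by (simp add: c_def powr_mult)
    also have "\<dots> \<le> prob ?N * W.prob ?B * W.prob ?B'"
      using N Bp left c1 by (intro mult_mono) auto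
    also have "\<dots> = prob ?G"
      using prob_count_and_jumps[OF _ B B', of "x + 1" n] x by simp
    also have "\<dots> \<le> prob {\<omega> \<in> space M. x < mid_argmin (\<lambda>t. V t \<omega>)}"
    proof (rule finite_measure_mono_AE)
      show "AE \<omega> in M. \<omega> \<in> ?G \<longrightarrow> \<omega> \<in> {\<omega> \<in> space M. x < mid_argmin (\<lambda>t. V t \<omega>)}"
        using AE_two_sided_path AE_space
      proof eventually_elim
        case (elim \<omega>)
        interpret two_sided_path "\<lambda>t. N1 t \<omega>" "\<lambda>t. N2 t \<omega>" "\<lambda>i. Z i \<omega>" "\<lambda>i. Z' i \<omega>"
          by (rule elim(1))
        show ?case
        proof
          assume "\<omega> \<in> ?G"
          then have "x + 1 \<le> mid_argmin v"
            using x by (intro mid_argmin_ge[of "x + 1" n K]) auto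
          then show "\<omega> \<in> {\<omega> \<in> space M. x < mid_argmin (\<lambda>t. V t \<omega>)}"
            using elim(2) by (simp add: V[OF elim(2)])
        qed
      qed
      note [measurable] = mid_argmin_measurable
      show "{\<omega> \<in> space M. x < mid_argmin (\<lambda>t. V t \<omega>)} \<in> sets M" by measurable
    qed
    finally show ?thesis .
  qed
  moreover have "0 < k" "0 < c" using c1 d by (auto simp: k_def c_def)
  ultimately show ?thesis by blast
qed

end

section \<open>Symmetric noise with a power tail\<close>

text \<open>
  On the dyadic shell \<open>2 ^ k < \<bar>\<xi>\<bar> \<le> 2 ^ (k + 1)\<close> the square is at most \<open>4 * 4 ^ k\<close>, so its
  expectation is dominated, up to the contribution of \<open>\<bar>\<xi>\<bar> \<le> 1\<close>, by a geometric series of ratio \<open>4 * 2 powr - g\<close>.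
\<close>
lemma (in prob_space) integrable_square_of_tail:
  fixes \<xi> :: "'a \<Rightarrow> real"
  assumes [measurable]: "\<xi> \<in> borel_measurable M" and g: "2 < g"
    and tail: "\<And>x. 0 < x \<Longrightarrow> prob {\<omega> \<in> space M. x < \<bar>\<xi> \<omega>\<bar>} \<le> x powr - g"
  shows "integrable M (\<lambda>\<omega>. (\<xi> \<omega>)\<^sup>2)"
proof (rule integrableI_bounded)
  define q where "q = 4 * 2 powr - g"
  have "2 powr - g < 2 powr - 2" using g by (intro powr_less_mono) auto
  then have q: "0 \<le> q" "q < 1" by (auto simp: q_def powr_minus powr_numeral)
  let ?f = "\<lambda>k \<omega>. ennreal (4 * 4 ^ k) * indicator {\<omega> \<in> space M. 2 ^ k < \<bar>\<xi> \<omega>\<bar>} \<omega>"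
  have "ennreal (norm ((\<xi> \<omega>)\<^sup>2)) \<le> 1 + (\<Sum>k. ?f k \<omega>)" if \<omega>: "\<omega> \<in> space M" for \<omega>
  proof (cases "\<bar>\<xi> \<omega>\<bar> \<le> 1")
    case True
    then have "(\<xi> \<omega>)\<^sup>2 \<le> 1" by (simp add: abs_square_le_1)
    then have "ennreal (norm ((\<xi> \<omega>)\<^sup>2)) \<le> 1" by simp
    then show ?thesis by (rule order_trans) simp
  next
    case False
    define n where "n = (LEAST n. \<bar>\<xi> \<omega>\<bar> \<le> 2 ^ n)"
    obtain n0 :: nat where "\<bar>\<xi> \<omega>\<bar> < 2 ^ n0" using real_arch_pow[of 2 "\<bar>\<xi> \<omega>\<bar>"] by auto
    then have n: "\<bar>\<xi> \<omega>\<bar> \<le> 2 ^ n"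
      unfolding n_def by (rule LeastI[of "\<lambda>n. \<bar>\<xi> \<omega>\<bar> \<le> 2 ^ n", OF less_imp_le])
    with False obtain k where k: "n = Suc k" by (cases n) auto
    have lower: "2 ^ k < \<bar>\<xi> \<omega>\<bar>"
      using not_less_Least[of k "\<lambda>n. \<bar>\<xi> \<omega>\<bar> \<le> 2 ^ n"] k unfolding n_def by simp
    have "\<bar>\<xi> \<omega>\<bar>\<^sup>2 \<le> (2 ^ n)\<^sup>2" using n by (intro power_mono) auto
    also have "(2 ^ n)\<^sup>2 = (4 * 4 ^ k :: real)"
      by (simp add: k power2_eq_square flip: power_mult_distrib)
    finally have "ennreal (norm ((\<xi> \<omega>)\<^sup>2)) \<le> ?f k \<omega>"
      using lower \<omega> by (simp add: ennreal_leI)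
    also have "\<dots> \<le> (\<Sum>k. ?f k \<omega>)"
    proof -
      have "(\<Sum>i\<in>{k}. ?f i \<omega>) \<le> (\<Sum>i. ?f i \<omega>)" by (intro sum_le_suminf summableI) auto
      then show ?thesis
        by (simp only: sum.insert finite.emptyI empty_iff not_False_eq_True sum.empty add_0_right)
    qed
    finally show ?thesis by (rule order_trans) simp
  qed
  then have "(\<integral>\<^sup>+\<omega>. ennreal (norm ((\<xi> \<omega>)\<^sup>2)) \<partial>M) \<le> (\<integral>\<^sup>+\<omega>. 1 + (\<Sum>k. ?f k \<omega>) \<partial>M)"
    by (rule nn_integral_mono)
  also have "\<dots> = 1 + (\<Sum>k. \<integral>\<^sup>+\<omega>. ?f k \<omega> \<partial>M)"
    by (subst nn_integral_add; (subst nn_integral_suminf)?) (auto simp: emeasure_space_1)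
  also have "\<dots> \<le> 1 + (\<Sum>k. ennreal (4 * q ^ k))"
  proof (intro add_left_mono suminf_le summableI)
    fix k
    have "prob {\<omega> \<in> space M. 2 ^ k < \<bar>\<xi> \<omega>\<bar>} \<le> (2 ^ k) powr - g" by (rule tail) simp
    also have "\<dots> = (2 powr - g) ^ k"
      by (simp add: powr_powr powr_realpow[symmetric] mult.commute)
    finally have "4 * 4 ^ k * prob {\<omega> \<in> space M. 2 ^ k < \<bar>\<xi> \<omega>\<bar>} \<le> 4 * 4 ^ k * (2 powr - g) ^ k"
      by (intro mult_left_mono) auto
    also have "\<dots> = 4 * q ^ k" by (simp add: q_def power_mult_distrib)
    finally show "(\<integral>\<^sup>+\<omega>. ?f k \<omega> \<partial>M) \<le> ennreal (4 * q ^ k)"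
      by (simp add: nn_integral_cmult emeasure_eq_measure ennreal_leI flip: ennreal_mult)
  qed
  also have "\<dots> < \<infinity>"
  proof -
    have "summable (\<lambda>k. 4 * q ^ k)" using q by (intro summable_mult summable_geometric) simp
    then have "(\<Sum>k. ennreal (4 * q ^ k)) = ennreal (\<Sum>k. 4 * q ^ k)"
      using q by (intro suminf_ennreal_eq[OF _ summable_sums]) auto
    then show ?thesis by simp
  qed
  finally show "(\<integral>\<^sup>+\<omega>. ennreal (norm ((\<xi> \<omega>)\<^sup>2)) \<partial>M) < \<infinity>" .
qed simp

locale heavy_tailed_noise = prob_space M for M :: "'a measure" +
  fixes \<xi> :: "'a \<Rightarrow> real" and g :: real
  assumes noise_measurable [measurable]: "\<xi> \<in> borel_measurable M"
    and exponent: "2 < g"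
    and symmetric: "distr M borel (\<lambda>\<omega>. - \<xi> \<omega>) = distr M borel \<xi>"
    and tail: "\<And>x. 0 \<le> x \<Longrightarrow> prob {\<omega> \<in> space M. x < \<bar>\<xi> \<omega>\<bar>} = 1 / (1 + x powr g)"
begin

lemma noise_square_integrable: "integrable M (\<lambda>\<omega>. (\<xi> \<omega>)\<^sup>2)"
proof (rule integrable_square_of_tail[OF noise_measurable exponent])
  fix x :: real assume "0 < x"
  then have "1 / (1 + x powr g) \<le> 1 / (x powr g)"
    by (intro divide_left_mono mult_pos_pos add_pos_pos) auto
  then show "prob {\<omega> \<in> space M. x < \<bar>\<xi> \<omega>\<bar>} \<le> x powr - g"
    using tail[of x] \<open>0 < x\<close> by (simp add: powr_minus_divide)
qed

lemma noise_integrable: "integrable M \<xi>"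
  by (rule square_integrable_imp_integrable[OF noise_measurable noise_square_integrable])

lemma expectation_reflect:
  assumes [measurable]: "f \<in> borel_measurable borel"
  shows "(\<integral>\<omega>. f (- \<xi> \<omega>) \<partial>M) = (\<integral>\<omega>. f (\<xi> \<omega>) \<partial>M :: real)"
proof -
  have "(\<integral>\<omega>. f (- \<xi> \<omega>) \<partial>M) = (\<integral>x. f x \<partial>distr M borel (\<lambda>\<omega>. - \<xi> \<omega>))"
    by (rule integral_distr[symmetric]) measurable
  also have "\<dots> = (\<integral>\<omega>. f (\<xi> \<omega>) \<partial>M)"
    unfolding symmetric by (rule integral_distr) measurable
  finally show ?thesis .
qed

lemma expectation_noise: "expectation \<xi> = 0"
  using expectation_reflect[of "\<lambda>x. x"] noise_integrable by simp

lemma prob_lower_tail: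
  assumes "0 \<le> u"
  shows "prob {\<omega> \<in> space M. \<xi> \<omega> < - u} = 1 / (2 * (1 + u powr g))"
proof -
  have "prob {\<omega> \<in> space M. \<xi> \<omega> < - u} = measure (distr M borel \<xi>) {..< - u}"
    by (subst measure_distr) (auto intro!: arg_cong[of _ _ prob])
  also have "\<dots> = prob {\<omega> \<in> space M. u < \<xi> \<omega>}"
    unfolding symmetric[symmetric]
    by (subst measure_distr) (auto intro!: arg_cong[of _ _ prob])
  finally have eq: "prob {\<omega> \<in> space M. \<xi> \<omega> < - u} = prob {\<omega> \<in> space M. u < \<xi> \<omega>}" .
  have "{\<omega> \<in> space M. u < \<bar>\<xi> \<omega>\<bar>} = {\<omega> \<in> space M. \<xi> \<omega> < - u} \<union> {\<omega> \<in> space M. u < \<xi> \<omega>}"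
    using assms by auto
  moreover have "prob ({\<omega> \<in> space M. \<xi> \<omega> < - u} \<union> {\<omega> \<in> space M. u < \<xi> \<omega>}) =
      prob {\<omega> \<in> space M. \<xi> \<omega> < - u} + prob {\<omega> \<in> space M. u < \<xi> \<omega>}"
    using assms by (intro finite_measure_Union) auto
  ultimately have "2 * prob {\<omega> \<in> space M. \<xi> \<omega> < - u} = 1 / (1 + u powr g)"
    using eq tail[OF assms] by simp
  moreover have "p = q / 2" if "2 * p = q" for p q :: real using that by simp
  ultimately have "prob {\<omega> \<in> space M. \<xi> \<omega> < - u} = 1 / (1 + u powr g) / 2" by blast
  then show ?thesis by (simp only: divide_divide_eq_left mult.commute)
qed

lemma drift_walk_l2:
  assumes "0 < \<delta>"
  shows "drift_walk (distr M borel (\<lambda>\<omega>. \<xi> \<omega> + \<delta> / 2))"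
proof -
  let ?D = "distr M borel (\<lambda>\<omega>. \<xi> \<omega> + \<delta> / 2)"
  have "prob_space ?D" by (rule prob_space_distr) measurable
  moreover have "integrable ?D (\<lambda>x. x\<^sup>2)"
    using noise_square_integrable noise_integrable
    by (subst integrable_distr_eq) (auto simp: power2_sum)
  moreover have "(\<integral>x. x \<partial>?D) = \<delta> / 2"
    using noise_integrable expectation_noise by (subst integral_distr) (auto simp: prob_space)
  ultimately show ?thesis
    using assms by (intro drift_walk_of_law) auto
qed

text \<open>
  By symmetry twice the expectation is that of \<open>\<bar>\<xi> + \<delta>\<bar> + \<bar>\<xi> - \<delta>\<bar> - 2 * \<bar>\<xi>\<bar>\<close>, which is nonnegative
  and at least \<open>\<delta>\<close> where \<open>\<bar>\<xi>\<bar> \<le> \<delta> / 2\<close>.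
\<close>
lemma expectation_l1_pos:
  assumes "0 < \<delta>"
  shows "0 < (\<integral>\<omega>. \<bar>\<xi> \<omega> + \<delta>\<bar> - \<bar>\<xi> \<omega>\<bar> \<partial>M)"
proof -
  let ?m = "\<integral>\<omega>. \<bar>\<xi> \<omega> + \<delta>\<bar> - \<bar>\<xi> \<omega>\<bar> \<partial>M"
  let ?E = "{\<omega> \<in> space M. \<bar>\<xi> \<omega>\<bar> \<le> \<delta> / 2}"
  have int: "integrable M (\<lambda>\<omega>. \<bar>\<xi> \<omega> + c\<bar> - \<bar>\<xi> \<omega>\<bar>)" for c
    using noise_integrable by auto
  have "prob {\<omega> \<in> space M. \<not> \<delta> / 2 < \<bar>\<xi> \<omega>\<bar>} = 1 - 1 / (1 + (\<delta> / 2) powr g)"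
    using tail[of "\<delta> / 2"] assms by (subst prob_neg) auto
  also have "\<dots> > 0" using assms by (simp add: field_simps add_pos_pos)
  finally have E: "0 < prob ?E" by (simp add: not_less)
  have "?m = (\<integral>\<omega>. \<bar>- \<xi> \<omega> + \<delta>\<bar> - \<bar>- \<xi> \<omega>\<bar> \<partial>M)"
    using expectation_reflect[of "\<lambda>x. \<bar>x + \<delta>\<bar> - \<bar>x\<bar>"] by simp
  also have "(\<lambda>\<omega>. \<bar>- \<xi> \<omega> + \<delta>\<bar> - \<bar>- \<xi> \<omega>\<bar>) = (\<lambda>\<omega>. \<bar>\<xi> \<omega> + - \<delta>\<bar> - \<bar>\<xi> \<omega>\<bar>)"
    by (auto simp: fun_eq_iff)
  finally have "2 * ?m = (\<integral>\<omega>. (\<bar>\<xi> \<omega> + \<delta>\<bar> - \<bar>\<xi> \<omega>\<bar>) + (\<bar>\<xi> \<omega> + - \<delta>\<bar> - \<bar>\<xi> \<omega>\<bar>) \<partial>M)"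
    using int[of \<delta>] int[of "- \<delta>"] by (subst Bochner_Integration.integral_add) auto
  moreover have "(\<integral>\<omega>. \<delta> * indicator ?E \<omega> \<partial>M) \<le> \<dots>"
  proof (rule integral_mono)
    show "integrable M (\<lambda>\<omega>. \<delta> * indicator ?E \<omega>)" by (simp add: emeasure_eq_measure)
    show "integrable M (\<lambda>\<omega>. (\<bar>\<xi> \<omega> + \<delta>\<bar> - \<bar>\<xi> \<omega>\<bar>) + (\<bar>\<xi> \<omega> + - \<delta>\<bar> - \<bar>\<xi> \<omega>\<bar>))"
      by (intro Bochner_Integration.integrable_add int)
    show "\<delta> * indicator ?E \<omega> \<le> (\<bar>\<xi> \<omega> + \<delta>\<bar> - \<bar>\<xi> \<omega>\<bar>) + (\<bar>\<xi> \<omega> + - \<delta>\<bar> - \<bar>\<xi> \<omega>\<bar>)" for \<omega>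
      by (cases "\<omega> \<in> ?E") auto
  qed
  ultimately have "\<delta> * prob ?E \<le> 2 * ?m" by simp
  moreover have "0 < \<delta> * prob ?E" using E assms by simp
  ultimately show ?thesis by linarith
qed

lemma drift_walk_l1:
  assumes "0 < \<delta>"
  shows "drift_walk (distr M borel (\<lambda>\<omega>. \<bar>\<xi> \<omega> + \<delta>\<bar> - \<bar>\<xi> \<omega>\<bar>))"
proof -
  let ?D = "distr M borel (\<lambda>\<omega>. \<bar>\<xi> \<omega> + \<delta>\<bar> - \<bar>\<xi> \<omega>\<bar>)"
  have "prob_space ?D" by (rule prob_space_distr) measurable
  moreover have "integrable ?D (\<lambda>x. x\<^sup>2)"
  proof (subst integrable_distr_eq)
    have "(\<bar>\<xi> \<omega> + \<delta>\<bar> - \<bar>\<xi> \<omega>\<bar>)\<^sup>2 \<le> \<delta>\<^sup>2" for \<omega>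
      using assms by (intro power2_le_iff_abs_le[THEN iffD2]) auto
    then show "integrable M (\<lambda>\<omega>. (\<bar>\<xi> \<omega> + \<delta>\<bar> - \<bar>\<xi> \<omega>\<bar>)\<^sup>2)"
      by (intro integrable_const_bound[where B="\<delta>\<^sup>2"]) auto
  qed auto
  moreover have "(\<integral>x. x \<partial>?D) = (\<integral>\<omega>. \<bar>\<xi> \<omega> + \<delta>\<bar> - \<bar>\<xi> \<omega>\<bar> \<partial>M)"
    by (subst integral_distr) auto
  ultimately show ?thesis
    using expectation_l1_pos[OF assms] by (intro drift_walk_of_law) auto
qed

lemma l2_lower_tail:
  assumes "0 < \<delta>" and y: "max 1 \<delta> \<le> y"
  shows "1 / (2 * (1 + 2 powr g)) * y powr - g \<le> measure (distr M borel (\<lambda>\<omega>. \<xi> \<omega> + \<delta> / 2)) {..< - y}"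
proof -
  have y1: "1 \<le> y" "\<delta> \<le> y" using y by auto
  have "1 + (y + \<delta> / 2) powr g \<le> 1 * y powr g + (2 * y) powr g"
    using y1 assms(1) exponent by (intro add_mono powr_mono2) (auto intro: ge_one_powr_ge_zero)
  also have "\<dots> = (1 + 2 powr g) * y powr g"
    using y1 by (simp add: powr_mult algebra_simps)
  finally have "1 / (2 * ((1 + 2 powr g) * y powr g)) \<le> 1 / (2 * (1 + (y + \<delta> / 2) powr g))"
    using y1 by (intro divide_left_mono mult_left_mono mult_pos_pos add_pos_nonneg) auto
  also have "\<dots> = prob {\<omega> \<in> space M. \<xi> \<omega> < - (y + \<delta> / 2)}"
    using y1 assms(1) by (intro prob_lower_tail[symmetric]) simp
  also have "\<dots> = measure (distr M borel (\<lambda>\<omega>. \<xi> \<omega> + \<delta> / 2)) {..< - y}"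
    by (subst measure_distr) (auto intro!: arg_cong[of _ _ prob])
  finally show ?thesis
    unfolding powr_minus_divide by (simp only: times_divide_times_eq mult_1_left mult.assoc)
qed

lemma iid_copies_l1:
  assumes "prob_space P" and "iid_copies P (distr M borel \<xi>) X"
  shows "iid_copies P (distr M borel (\<lambda>\<omega>. \<bar>\<xi> \<omega> + \<delta>\<bar> - \<bar>\<xi> \<omega>\<bar>)) (\<lambda>i \<omega>. \<bar>X i \<omega> + \<delta>\<bar> - \<bar>X i \<omega>\<bar>)"
proof -
  interpret P: prob_space P by (rule assms(1))
  have ind: "P.indep_vars (\<lambda>_. borel) X UNIV" and law: "\<And>i. distr P borel (X i) = distr M borel \<xi>"
    using assms(2) by (auto simp: iid_copies_def)
  have Xm: "X i \<in> borel_measurable P" for i using ind by (auto simp: P.indep_vars_def)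
  let ?h = "\<lambda>x::real. \<bar>x + \<delta>\<bar> - \<bar>x\<bar>"
  have hm: "?h \<in> borel_measurable borel" by measurable
  have "P.indep_vars (\<lambda>_. borel) (\<lambda>i \<omega>. ?h (X i \<omega>)) UNIV"
    by (rule P.indep_vars_compose2[OF ind]) (rule hm)
  moreover have "distr P borel (\<lambda>\<omega>. ?h (X i \<omega>)) = distr M borel (\<lambda>\<omega>. ?h (\<xi> \<omega>))" for i
    using distr_distr[OF hm Xm[of i]] distr_distr[OF hm noise_measurable] law[of i]
    by (simp add: comp_def)
  ultimately show ?thesis by (simp add: iid_copies_def)
qed

end

section \<open>The two change point limits\<close>

theorem theorem2p4:
  fixes \<alpha>\<^sub>0 \<beta>\<^sub>0 d\<^sub>0 \<gamma> \<mu>\<^sub>0 pstar :: real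
    and fX :: "real \<Rightarrow> real" and F1 F2 :: "real \<Rightarrow> real"
    and M :: "'a measure" and X \<xi> :: "'a \<Rightarrow> real"
    and M1 :: "'b measure" and V1 :: "real \<Rightarrow> 'b \<Rightarrow> real"
    and M2 :: "'c measure" and V2 :: "real \<Rightarrow> 'c \<Rightarrow> real"
    and P :: "'d measure" and \<xi>s :: "nat \<Rightarrow> 'd \<Rightarrow> real"
  assumes "\<alpha>\<^sub>0 \<noteq> \<beta>\<^sub>0"
    and "prob_space M"
    and "\<xi> \<in> borel_measurable M"
    and "\<And>x. 0 \<le> fX x"
    and "distributed M lborel X (\<lambda>x. ennreal (fX x))"
    and "prob_space.indep_var M borel X borel \<xi>"
    and "fX d\<^sub>0 > 0"
    and "\<gamma> > 2"
    and "distr M borel (\<lambda>\<omega>. - \<xi> \<omega>) = distr M borel \<xi>"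
    and "\<And>x. x \<ge> 0 \<Longrightarrow> \<P>(\<omega> in M. \<bar>\<xi> \<omega>\<bar> > x) = 1 / (1 + x powr \<gamma>)"
    and "is_CPP M1 (distr M borel (\<lambda>\<omega>. \<bar>\<xi> \<omega> + \<bar>\<alpha>\<^sub>0 - \<beta>\<^sub>0\<bar>\<bar> - \<bar>\<xi> \<omega>\<bar>)) (fX d\<^sub>0) V1"
    and "is_CPP M2 (distr M borel (\<lambda>\<omega>. \<xi> \<omega> + \<bar>\<alpha>\<^sub>0 - \<beta>\<^sub>0\<bar> / 2)) (fX d\<^sub>0) V2"
    and "prob_space P"
    and "iid_copies P (distr M borel \<xi>) \<xi>s"
  defines "F1 \<equiv> \<lambda>x. \<P>(\<omega> in M1. mid_argmin (\<lambda>t. V1 t \<omega>) \<le> x)"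
    and "F2 \<equiv> \<lambda>x. \<P>(\<omega> in M2. mid_argmin (\<lambda>t. V2 t \<omega>) \<le> x)"
    and "\<mu>\<^sub>0 \<equiv> (\<integral>\<omega>. \<bar>\<xi> \<omega> + \<bar>\<alpha>\<^sub>0 - \<beta>\<^sub>0\<bar>\<bar> - \<bar>\<xi> \<omega>\<bar> \<partial>M)"
    and "pstar \<equiv> \<P>(\<omega> in P.
           (INF i\<in>{1..}. ereal (\<Sum>j<i. \<bar>\<xi>s j \<omega> + \<bar>\<alpha>\<^sub>0 - \<beta>\<^sub>0\<bar>\<bar> - \<bar>\<xi>s j \<omega>\<bar>)) > 0)"
  shows "(\<exists>k\<^sub>0>0. \<exists>c\<^sub>0>0. \<forall>x\<ge>k\<^sub>0.
            1 - F2 x \<ge> c\<^sub>0 / (2 * fX d\<^sub>0 powr \<gamma>) * x powr (- \<gamma>))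
       \<and> \<mu>\<^sub>0 > 0 \<and> pstar > 0
       \<and> (\<forall>x>0. 1 - F1 x \<le>
            pstar / (exp (\<mu>\<^sub>0\<^sup>2 / (8 * (\<alpha>\<^sub>0 - \<beta>\<^sub>0)\<^sup>2)) - 1)
            * exp (- (x * fX d\<^sub>0 * (1 - exp (- (\<mu>\<^sub>0\<^sup>2 / (8 * (\<alpha>\<^sub>0 - \<beta>\<^sub>0)\<^sup>2)))))))"
proof -
  define \<delta> where "\<delta> = \<bar>\<alpha>\<^sub>0 - \<beta>\<^sub>0\<bar>"
  have \<delta>: "0 < \<delta>" using assms(1) by (simp add: \<delta>_def)
  have \<delta>_sq: "(\<alpha>\<^sub>0 - \<beta>\<^sub>0)\<^sup>2 = \<delta>\<^sup>2" by (simp add: \<delta>_def)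
  interpret noise: heavy_tailed_noise M \<xi> \<gamma>
    using assms(2,3,8-10) by (intro heavy_tailed_noise.intro heavy_tailed_noise_axioms.intro) auto
  let ?D1 = "distr M borel (\<lambda>\<omega>. \<bar>\<xi> \<omega> + \<delta>\<bar> - \<bar>\<xi> \<omega>\<bar>)"
  let ?D2 = "distr M borel (\<lambda>\<omega>. \<xi> \<omega> + \<delta> / 2)"
  obtain N1 N2 Z Z' where "two_sided_cpp M1 ?D1 (fX d\<^sub>0) N1 N2 Z Z' V1"
    using two_sided_cpp_of_is_CPP[OF assms(11)[folded \<delta>_def] noise.drift_walk_l1[OF \<delta>]] .
  then interpret L1: two_sided_cpp M1 ?D1 "fX d\<^sub>0" N1 N2 Z Z' V1 .
  obtain N1' N2' Y Y' where "two_sided_cpp M2 ?D2 (fX d\<^sub>0) N1' N2' Y Y' V2"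
    using two_sided_cpp_of_is_CPP[OF assms(12)[folded \<delta>_def] noise.drift_walk_l2[OF \<delta>]] .
  then interpret L2: two_sided_cpp M2 ?D2 "fX d\<^sub>0" N1' N2' Y Y' V2 .
  have \<mu>: "\<mu>\<^sub>0 = L1.W.drift"
    unfolding \<mu>\<^sub>0_def L1.W.drift_def \<delta>_def[symmetric] by (subst integral_distr) auto
  have pstar: "pstar = L1.W.escape"
    unfolding pstar_def \<delta>_def[symmetric]
    by (rule L1.W.escape_eq_INF[OF assms(13) noise.iid_copies_l1[OF assms(13,14)]])
  have bounded: "AE y in ?D1. \<bar>y\<bar> \<le> \<delta>"
    using \<delta> by (subst AE_distr_iff) auto
  have upper: "1 - F1 x \<le>
            pstar / (exp (\<mu>\<^sub>0\<^sup>2 / (8 * (\<alpha>\<^sub>0 - \<beta>\<^sub>0)\<^sup>2)) - 1)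
            * exp (- (x * fX d\<^sub>0 * (1 - exp (- (\<mu>\<^sub>0\<^sup>2 / (8 * (\<alpha>\<^sub>0 - \<beta>\<^sub>0)\<^sup>2))))))" if "0 < x" for x
    unfolding F1_def L1.one_minus_prob_mid_argmin \<delta>_sq \<mu> pstar
    by (rule L1.prob_mid_argmin_gt_le[OF that \<delta> bounded])
  have "\<exists>k>0. \<exists>c>0. \<forall>x\<ge>k. c * x powr - \<gamma> \<le> 1 - F2 x"
    unfolding F2_def L2.one_minus_prob_mid_argmin
  proof (rule L2.prob_mid_argmin_gt_ge)
    show "0 < 1 / (2 * (1 + 2 powr \<gamma>))" by (intro divide_pos_pos mult_pos_pos add_pos_pos) auto
  qed (rule noise.l2_lower_tail[OF \<delta>])
  then obtain k c where kc: "0 < k" "0 < c" "\<And>x. k \<le> x \<Longrightarrow> c * x powr - \<gamma> \<le> 1 - F2 x" by blast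
  have "\<exists>k\<^sub>0>0. \<exists>c\<^sub>0>0. \<forall>x\<ge>k\<^sub>0. 1 - F2 x \<ge> c\<^sub>0 / (2 * fX d\<^sub>0 powr \<gamma>) * x powr (- \<gamma>)"
  proof (rule exI[of _ k], rule conjI[OF kc(1)], rule exI[of _ "c * (2 * fX d\<^sub>0 powr \<gamma>)"],
      intro conjI allI impI)
    show "0 < c * (2 * fX d\<^sub>0 powr \<gamma>)" using kc assms(7) by simp
    show "c * (2 * fX d\<^sub>0 powr \<gamma>) / (2 * fX d\<^sub>0 powr \<gamma>) * x powr - \<gamma> \<le> 1 - F2 x" if "k \<le> x" for x
      using kc(3)[OF that] assms(7) by simp
  qed
  moreover have "0 < \<mu>\<^sub>0" unfolding \<mu>\<^sub>0_def \<delta>_def[symmetric] by (rule noise.expectation_l1_pos[OF \<delta>])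
  moreover have "0 < pstar" unfolding pstar by (rule L1.W.escape_pos)
  ultimately show ?thesis using upper by blast
qed

end
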